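(* Let $R$ be a non-zero ring with identity (not necessarily commutative), let $n\ge1$, and let $f(Z)=Z^n-a_1Z^{n-1}+\cdots+(-1)^{n-1}a_{n-1}Z+(-1)^na_n\in R[Z]$, where $a_1,\dots,a_n$ are central in $R$. Let $I_f$ be the two-sided ideal of $R[X_1,\dots,X_n]$ generated by $\sigma_1-a_1,\dots,\sigma_n-a_n$, where $\sigma_1,\dots,\sigma_n$ are the elementary symmetric polynomials, and let $R_f=R[X_1,\dots,X_n]/I_f$. Let $V$ be the free right $R$-module and $L_{Y_1},\dots,L_{Y_n}\in\mathrm{End}_R(V)$ the operators defined in the context. Then $L_{Y_1},\dots,L_{Y_n}$ commute with each other and with the action of $R$ on $V$ by left multiplication. The corresponding ring homomorphism $R[X_1,\dots,X_n]\to\mathrm{End}_R(V)$, which extends the action of $R$ on $V$ by left multiplication and satisfies $X_i\mapsto L_{Y_i}$ for $1\le i\le n$, has kernel $I_f$ and, consequently, $R_f\cong R[L_{Y_1},\dots,L_{Y_n}]$ as rings.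
   Context: In $R[X_1,\dots,X_n]$ the variables commute with each other and with all elements of $R$. View $R[X_1,\dots,X_n]$ as a right $R$-module; $R$ acts on it by right-$R$-module endomorphisms via left multiplication. $V$ is the right $R$-submodule spanned by all monomials $X_1^{\alpha_1}\cdots X_n^{\alpha_n}$ with $0\le\alpha_i\le n-i$ for $1\le i\le n$; it is stable under left multiplication by $R$. $R[L_{Y_1},\dots,L_{Y_n}]$ is the subring of $\mathrm{End}_R(V)$ generated by $L_{Y_1},\dots,L_{Y_n}$ and the left multiplications by elements of $R$. Polynomials $f_i$: $f_1(X_1)=f(X_1)$ and, for $1\le i<n$, $f_{i+1}(X_1,\dots,X_{i+1})$ is the exact quotient of $f_i(X_1,\dots,X_{i-1},X_{i+1})-f_i(X_1,\dots,X_{i-1},X_i)$ by $X_{i+1}-X_i$. Each $f_i\in R[X_1,\dots,X_i]$ is monic of degree $n-(i-1)$ in $X_i$. Operators: $L_{Y_1},\dots,L_{Y_n}$ are right $R$-linear endomorphisms of $V$ defined inductively on the monomial basis. (i) $L_{Y_1}X_1^{\alpha_1}\cdots X_n^{\alpha_n}=X_1^{\alpha_1+1}X_2^{\alpha_2}\cdots X_n^{\alpha_n}$ if $\alpha_1<n-1$, and $L_{Y_1}X_1^{n-1}X_2^{\alpha_2}\cdots X_n^{\alpha_n}=a_1X_1^{n-1}X_2^{\alpha_2}\cdots X_n^{\alpha_n}-a_2X_1^{n-2}X_2^{\alpha_2}\cdots X_n^{\alpha_n}+\cdots+(-1)^{n-1}a_nX_2^{\alpha_2}\cdots X_n^{\alpha_n}$.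 (ii) Let $1<i\le n$ and suppose $L_{Y_1},\dots,L_{Y_{i-1}}$ have been defined. Let $R\langle Y_1,\dots,Y_{i-1}\rangle$ be the ring of polynomials over $R$ in non-commuting variables $Y_1,\dots,Y_{i-1}$, and let $L^{i-1}:R\langle Y_1,\dots,Y_{i-1}\rangle\to\mathrm{End}_R(V)$, $p\mapsto L^{i-1}_p$, be the ring homomorphism extending the left multiplication action of $R$ on $V$ and sending $Y_j\mapsto L_{Y_j}$ for $1\le j\le i-1$. Write uniquely $$X_i^{n-(i-1)}-f_i(X_1,\dots,X_i)=h_{n-i}(X_1,\dots,X_{i-1})X_i^{n-i}+\cdots+h_0(X_1,\dots,X_{i-1}),$$ with $h_{n-i},\dots,h_0\in R[X_1,\dots,X_{i-1}]$. Here $h_k(Y_1,\dots,Y_{i-1})$ is obtained from $h_k$ by replacing each monomial $X_1^{\beta_1}\cdots X_{i-1}^{\beta_{i-1}}$ by $Y_1^{\beta_1}\cdots Y_{i-1}^{\beta_{i-1}}$. Then $$L_{Y_i}X_1^{\alpha_1}\cdots X_i^{\alpha_i}\cdots X_n^{\alpha_n}=X_1^{\alpha_1}\cdots X_i^{\alpha_i+1}\cdots X_n^{\alpha_n}\quad\text{if }\alpha_i<n-i,$$ $$L_{Y_i}X_1^{\alpha_1}\cdots X_i^{n-i}\cdots X_n^{\alpha_n}=\sum_{k=0}^{n-i}L^{i-1}_{h_k(Y_1,\dots,Y_{i-1})}\,X_1^{\alpha_1}\cdots X_i^{k}\cdots X_n^{\alpha_n}.$$ *)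

theory Defs
  imports "HOL-Library.Poly_Mapping" "HOL-Library.FuncSet"
    "HOL-Algebra.QuotRing" "HOL-Algebra.Generated_Rings"
begin

text \<open>
  The coefficient ring $R$ is a type \<open>'a\<close> of class \<^class>\<open>ring_1\<close>, i.e. a non-zero, not necessarily
  commutative ring with identity. A polynomial is a finitely supported map from exponent vectors
  to coefficients. The convolution product of \<^theory>\<open>HOL-Library.Poly_Mapping\<close> makes the variables
  commute with each other and with all coefficients, and it does not require the coefficients to
  commute among themselves. Variables are numbered from 1.
\<close>

type_synonym expo = "nat \<Rightarrow>\<^sub>0 nat"
type_synonym 'a mpol = "expo \<Rightarrow>\<^sub>0 'a"

definition mon :: "expo \<Rightarrow> 'a::ring_1 mpol"
  where "mon m = Poly_Mapping.single m 1"

definition cst :: "'a::ring_1 \<Rightarrow> 'a mpol"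
  where "cst r = Poly_Mapping.single 0 r"

definition polyX :: "nat \<Rightarrow> 'a::ring_1 mpol"
  where "polyX i = mon (Poly_Mapping.single i 1)"

definition polys :: "nat \<Rightarrow> 'a::ring_1 mpol set"
  where "polys n = {p. \<forall>m\<in>Poly_Mapping.keys p. Poly_Mapping.keys m \<subseteq> {1..n}}"

definition poly_ring :: "nat \<Rightarrow> 'a::ring_1 mpol ring"
  where "poly_ring n = \<lparr>carrier = polys n, mult = (*), one = 1, zero = 0, add = (+)\<rparr>"

text \<open>The products are written as monomials because the class of commutative monoids, which
  \<^const>\<open>prod\<close> needs, is not available for a noncommutative coefficient ring.\<close>

definition elem_sym :: "nat \<Rightarrow> nat \<Rightarrow> 'a::ring_1 mpol"
  where "elem_sym n k = (\<Sum>S | S \<subseteq> {1..n} \<and> card S = k. mon (\<Sum>i\<in>S. Poly_Mapping.single i 1))"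

definition ideal_f :: "nat \<Rightarrow> (nat \<Rightarrow> 'a::ring_1) \<Rightarrow> 'a mpol set"
  where "ideal_f n a = Idl\<^bsub>poly_ring n\<^esub> ((\<lambda>k. elem_sym n k - cst (a k)) ` {1..n})"


subsection \<open>The polynomials $f_i$\<close>

definition f_at :: "nat \<Rightarrow> (nat \<Rightarrow> 'a::ring_1) \<Rightarrow> 'a mpol \<Rightarrow> 'a mpol"
  where "f_at n a z = z ^ n + (\<Sum>k=1..n. (- 1) ^ k * cst (a k) * z ^ (n - k))"

definition subst_next :: "nat \<Rightarrow> 'a::ring_1 mpol \<Rightarrow> 'a mpol"
  \<comment> \<open>substitutes $X_{i+1}$ for $X_i$\<close>
  where "subst_next i p = (\<Sum>m\<in>Poly_Mapping.keys p. Poly_Mapping.single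
    (Poly_Mapping.update i 0 m + Poly_Mapping.single (Suc i) (Poly_Mapping.lookup m i))
    (Poly_Mapping.lookup p m))"

text \<open>The exact quotient exists, and it is unique because $X_{i+1} - X_i$ is not a zero divisor.\<close>

fun f_seq :: "nat \<Rightarrow> (nat \<Rightarrow> 'a::ring_1) \<Rightarrow> nat \<Rightarrow> 'a mpol" where
  "f_seq n a 0 = 0" \<comment> \<open>unused\<close>
| "f_seq n a (Suc 0) = f_at n a (polyX 1)"
| "f_seq n a (Suc (Suc j)) = (let i = Suc j in
     THE q. q \<in> polys (Suc i) \<and>
       q * (polyX (Suc i) - polyX i) = subst_next i (f_seq n a i) - f_seq n a i)"

definition coeff_of_power :: "nat \<Rightarrow> nat \<Rightarrow> 'a::ring_1 mpol \<Rightarrow> 'a mpol"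
  \<comment> \<open>the coefficient of $X_i^k$, a polynomial in the remaining variables\<close>
  where "coeff_of_power i k p =
    (\<Sum>m | m \<in> Poly_Mapping.keys p \<and> Poly_Mapping.lookup m i = k.
       Poly_Mapping.single (Poly_Mapping.update i 0 m) (Poly_Mapping.lookup p m))"

definition h_coeff :: "nat \<Rightarrow> (nat \<Rightarrow> 'a::ring_1) \<Rightarrow> nat \<Rightarrow> nat \<Rightarrow> 'a mpol"
  where "h_coeff n a i k = coeff_of_power i k (polyX i ^ (n - (i - 1)) - f_seq n a i)"


subsection \<open>The right module $V$ and its endomorphism ring\<close>

text \<open>The right action of $r$ on a polynomial \<open>p\<close> is \<open>p * cst r\<close>, the left action is \<open>cst r * p\<close>.\<close>

definition staircase :: "nat \<Rightarrow> expo set"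
  where "staircase n =
    {m. Poly_Mapping.keys m \<subseteq> {1..n} \<and> (\<forall>i\<in>{1..n}. Poly_Mapping.lookup m i \<le> n - i)}"

definition V_mod :: "nat \<Rightarrow> 'a::ring_1 mpol set"
  where "V_mod n = {\<Sum>m\<in>staircase n. mon m * cst (r m) | r. True}"

definition End_V :: "nat \<Rightarrow> ('a::ring_1 mpol \<Rightarrow> 'a mpol) ring"
  where "End_V n = \<lparr>
    carrier = {T \<in> V_mod n \<rightarrow>\<^sub>E V_mod n. (\<forall>p\<in>V_mod n. \<forall>q\<in>V_mod n. T (p + q) = T p + T q) \<and>
                               (\<forall>p\<in>V_mod n. \<forall>r. T (p * cst r) = T p * cst r)},
    mult = compose (V_mod n),
    one = (\<lambda>p\<in>V_mod n. p),
    zero = (\<lambda>p\<in>V_mod n. 0),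
    add = (\<lambda>S T. \<lambda>p\<in>V_mod n. S p + T p)\<rparr>"

definition left_mult :: "nat \<Rightarrow> 'a::ring_1 \<Rightarrow> 'a mpol \<Rightarrow> 'a mpol"
  where "left_mult n r = (\<lambda>p\<in>V_mod n. cst r * p)"

definition right_lin_ext :: "nat \<Rightarrow> (expo \<Rightarrow> 'a::ring_1 mpol) \<Rightarrow> 'a mpol \<Rightarrow> 'a mpol"
  \<comment> \<open>the right $R$-linear map on $V$ with prescribed values on the basis monomials\<close>
  where "right_lin_ext n g =
    (\<lambda>p\<in>V_mod n. \<Sum>m\<in>Poly_Mapping.keys p. g m * cst (Poly_Mapping.lookup p m))"


subsection \<open>The operators $L_{Y_i}$\<close>

text \<open>
  An element of $R\langle Y_1, \dots, Y_{i-1} \rangle$ is represented as a combination of words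
  in the indices of the variables, with coefficients on the left. The word \<open>[j\<^sub>1, \<dots>, j\<^sub>l]\<close>
  stands for $Y_{j_1} \cdots Y_{j_l}$.
\<close>

type_synonym 'a ncpol = "nat list \<Rightarrow>\<^sub>0 'a"

definition ordered_word :: "nat \<Rightarrow> expo \<Rightarrow> nat list"
  \<comment> \<open>$X_1^{\beta_1} \cdots X_{i-1}^{\beta_{i-1}} \mapsto Y_1^{\beta_1} \cdots Y_{i-1}^{\beta_{i-1}}$\<close>
  where "ordered_word i b = concat (map (\<lambda>j. replicate (Poly_Mapping.lookup b j) j) [1..<i])"

definition to_nc :: "nat \<Rightarrow> 'a::ring_1 mpol \<Rightarrow> 'a ncpol"
  where "to_nc i p = (\<Sum>b\<in>Poly_Mapping.keys p.
    Poly_Mapping.single (ordered_word i b) (Poly_Mapping.lookup p b))"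

text \<open>The endomorphism $L^{i-1}_p$, where \<open>L j\<close> is $L_{Y_j}$ for $1 \le j \le i-1$.\<close>

definition nc_act ::
  "nat \<Rightarrow> (nat \<Rightarrow> 'a::ring_1 mpol \<Rightarrow> 'a mpol) \<Rightarrow> 'a ncpol \<Rightarrow> 'a mpol \<Rightarrow> 'a mpol"
  where "nc_act n L p =
    (\<lambda>v\<in>V_mod n. \<Sum>w\<in>Poly_Mapping.keys p. cst (Poly_Mapping.lookup p w) * List.foldr L w v)"

definition L_first :: "nat \<Rightarrow> (nat \<Rightarrow> 'a::ring_1) \<Rightarrow> expo \<Rightarrow> 'a mpol"
  where "L_first n a m =
    (if Poly_Mapping.lookup m 1 < n - 1 then mon (m + Poly_Mapping.single 1 1)
     else \<Sum>k=1..n. (- 1) ^ (k - 1) * cst (a k) * mon (Poly_Mapping.update 1 (n - k) m))"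

definition L_later :: "nat \<Rightarrow> (nat \<Rightarrow> 'a::ring_1) \<Rightarrow> (nat \<Rightarrow> 'a mpol \<Rightarrow> 'a mpol) \<Rightarrow>
    nat \<Rightarrow> expo \<Rightarrow> 'a mpol"
  where "L_later n a L i m =
    (if Poly_Mapping.lookup m i < n - i then mon (m + Poly_Mapping.single i 1)
     else \<Sum>k=0..n - i. nc_act n L (to_nc i (h_coeff n a i k)) (mon (Poly_Mapping.update i k m)))"

text \<open>\<open>L_upto n a i\<close> is the family $L_{Y_1}, \dots, L_{Y_i}$; its values at other indices are
  irrelevant.\<close>

fun L_upto :: "nat \<Rightarrow> (nat \<Rightarrow> 'a::ring_1) \<Rightarrow> nat \<Rightarrow> nat \<Rightarrow> 'a mpol \<Rightarrow> 'a mpol" where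
  "L_upto n a 0 = (\<lambda>_. undefined)"
| "L_upto n a (Suc j) = (L_upto n a j)(Suc j := right_lin_ext n
     (if j = 0 then L_first n a else L_later n a (L_upto n a j) (Suc j)))"

definition LY :: "nat \<Rightarrow> (nat \<Rightarrow> 'a::ring_1) \<Rightarrow> nat \<Rightarrow> 'a mpol \<Rightarrow> 'a mpol"
  where "LY n a = L_upto n a n"

definition R_LY :: "nat \<Rightarrow> (nat \<Rightarrow> 'a::ring_1) \<Rightarrow> ('a mpol \<Rightarrow> 'a mpol) ring"
  \<comment> \<open>$R[L_{Y_1}, \dots, L_{Y_n}]$\<close>
  where "R_LY n a = (End_V n)
    \<lparr>carrier := generate_ring (End_V n) (LY n a ` {1..n} \<union> range (left_mult n))\<rparr>"

definition extending_homs :: "nat \<Rightarrow> (nat \<Rightarrow> 'a::ring_1) \<Rightarrow> ('a mpol \<Rightarrow> 'a mpol \<Rightarrow> 'a mpol) set"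
  where "extending_homs n a = {\<Phi> \<in> ring_hom (poly_ring n) (End_V n).
    (\<forall>r. \<Phi> (cst r) = left_mult n r) \<and> (\<forall>i\<in>{1..n}. \<Phi> (polyX i) = LY n a i)}"

end

theory Submission
  imports Defs
begin

text \<open>
  All $f_i$ are divided differences of $f$, and those of $\prod_j (Z - X_j)$ vanish. Comparing the
  two shows that $f_1, \dots, f_n$ and $\sigma_1 - a_1, \dots, \sigma_n - a_n$ are related by a
  unitriangular system, so they generate the same ideal. Since $f_i$ is monic in $X_i$ and does not
  involve later variables, dividing by $f_n, \dots, f_1$ in turn gives a right linear normal form
  $R[X_1, \dots, X_n] \to V$ that is the identity on $V$ and has kernel $I_f$. Hence
  $p \cdot v = $ normal form of $pv$ defines an action of $R[X_1, \dots, X_n]$ on $V$ with kernel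
  $I_f$, and $X_i$ acts as $L_{Y_i}$.
\<close>


subsection \<open>Polynomials with central variables\<close>

text \<open>That the operators commute is hard to read off their recursive definition, where
  \<open>L_later\<close> applies earlier operators in a prescribed order of letters. No such
  computation is made: by induction on i, L_{Y_i} turns out to be multiplication by X_i followed by
  the normal form, and these maps commute because variables are central. Non-commutativity of R is
  controlled through the centrality of the a_k. It makes every f_i and every coefficient used in the
  divisions central, so remainders can be moved past coefficients and the normal form is R-linear on
  both sides. The order of the divisions matters: reducing X_i changes only exponents of X_1, ...,
  X_i, so the bounds already reached for later variables survive. The kernel needs both halves of
  the comparison of generators: that p minus its normal form lies in I_f uses that the f_i lie in
  I_f, while the vanishing of the normal form on I_f uses that the generators are combinations of
  the f_i. The action has no larger kernel because V contains 1.\<close>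

lemma cst_simps [simp]: "cst 0 = 0" "cst 1 = 1"
  by (simp_all add: cst_def)

lemma cst_add: "cst (r + s) = cst r + cst s"
  by (simp add: cst_def Poly_Mapping.single_add)

lemma cst_mult: "cst (r * s) = cst r * cst s"
  by (simp add: cst_def mult_single)

lemma mon_0 [simp]: "mon 0 = 1"
  by (simp add: mon_def)

lemma mon_add: "mon (m + m') = mon m * mon m'"
  by (simp add: mon_def mult_single)

lemma mon_mult_cst: "mon m * cst r = Poly_Mapping.single m r"
  by (simp add: mon_def cst_def mult_single)

lemma cst_mult_mon: "cst r * mon m = Poly_Mapping.single m r"
  by (simp add: mon_def cst_def mult_single)

lemma mon_single: "(mon (Poly_Mapping.single i k) :: 'a::ring_1 mpol) = polyX i ^ k"
proof (induction k)
  case (Suc k)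
  have "(mon (Poly_Mapping.single i (Suc k)) :: 'a mpol) = mon (Poly_Mapping.single i 1 + Poly_Mapping.single i k)"
    by (simp flip: Poly_Mapping.single_add)
  then show ?case using Suc by (simp only: mon_add polyX_def power_Suc)
qed simp

lemma keys_cst: "Poly_Mapping.keys (cst r) \<subseteq> {0}"
  by (simp add: cst_def)

lemma keys_mon [simp]: "Poly_Mapping.keys (mon m :: 'a::ring_1 mpol) = {m}"
  by (simp add: mon_def)

lemma mpol_expand: "p = (\<Sum>m\<in>Poly_Mapping.keys p. Poly_Mapping.single m (Poly_Mapping.lookup p m))"
  by (rule poly_mapping_eqI)
     (auto simp: lookup_sum lookup_single when_def in_keys_iff)

text \<open>The set \<open>A\<close> carries a restriction on the support, such as the absence of a
  variable, down to the single terms.\<close>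

lemma mpol_induct [consumes 1, case_names zero single add]:
  assumes "Poly_Mapping.keys p \<subseteq> A"
    and "P (0 :: 'a \<Rightarrow>\<^sub>0 'b::comm_monoid_add)" and "\<And>m r. m \<in> A \<Longrightarrow> P (Poly_Mapping.single m r)"
    and "\<And>p q. P p \<Longrightarrow> P q \<Longrightarrow> P (p + q)"
  shows "P p"
proof -
  have "P (\<Sum>m\<in>B. Poly_Mapping.single m (Poly_Mapping.lookup p m))" if "finite B" "B \<subseteq> A" for B
    using that by (induction B) (auto intro: assms)
  then show ?thesis
    using mpol_expand[of p] assms(1) by (metis finite_keys)
qed

lemmas mpol_induct_all = mpol_induct[OF subset_UNIV, case_names zero single add]

text \<open>Right R-linear extension from monomials. Substitution, division with remainder and
  extraction of coefficients are all instances of it, so their additivity and right linearity are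
  proved once.\<close>

definition lin :: "(expo \<Rightarrow> 'a::ring_1 mpol) \<Rightarrow> 'a mpol \<Rightarrow> 'a mpol"
  where "lin g p = (\<Sum>m\<in>Poly_Mapping.keys p. g m * cst (Poly_Mapping.lookup p m))"

lemma lin_0 [simp]: "lin g 0 = 0"
  by (simp add: lin_def)

lemma lin_add: "lin g (p + q) = lin g p + lin g q"
  unfolding lin_def by (rule setsum_keys_plus_distrib) (simp_all add: cst_add distrib_left)

lemma lin_single: "lin g (Poly_Mapping.single m r) = g m * cst r"
  by (simp add: lin_def)

lemma lin_mon [simp]: "lin g (mon m) = g m"
  by (simp add: mon_def lin_single)

lemma lin_uminus: "lin g (- p) = - lin g p"
  using lin_add[of g p "- p"] by (simp add: eq_neg_iff_add_eq_0 add.commute)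

lemma lin_diff: "lin g (p - q) = lin g p - lin g q"
  using lin_add[of g p "- q"] by (simp add: lin_uminus)

lemma single_mult_cst: "Poly_Mapping.single m r * cst s = Poly_Mapping.single m (r * s)"
  by (simp add: cst_def mult_single)

lemma lin_mult_cst: "lin g (p * cst r) = lin g p * cst r"
  by (induction p rule: mpol_induct_all)
     (simp_all add: lin_single single_mult_cst lin_add distrib_right cst_mult mult.assoc)

lemma lin_eqI:
  assumes "\<And>p q. h (p + q) = h p + h q" and "\<And>m r. h (Poly_Mapping.single m r) = g m * cst r"
  shows "h p = lin g p"
proof (induction p rule: mpol_induct_all)
  case zero
  then show ?case using assms(1)[of 0 0] by simp
qed (simp_all add: assms lin_add lin_single)

lemma keys_add_subset:
  "Poly_Mapping.keys p \<subseteq> A \<Longrightarrow> Poly_Mapping.keys q \<subseteq> A \<Longrightarrow> Poly_Mapping.keys (p + q) \<subseteq> A"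
  using keys_add[of p q] by blast

lemma keys_sum_subset:
  "(\<And>x. x \<in> I \<Longrightarrow> Poly_Mapping.keys (f x) \<subseteq> A) \<Longrightarrow> Poly_Mapping.keys (\<Sum>x\<in>I. f x) \<subseteq> A"
  using keys_sum[of f I] by blast

lemma keys_mult_cst: "Poly_Mapping.keys (p * cst r) \<subseteq> Poly_Mapping.keys p"
  using keys_mult[of p "cst r"] keys_cst[of r] by force

lemma keys_cst_mult: "Poly_Mapping.keys (cst r * p) \<subseteq> Poly_Mapping.keys p"
  using keys_mult[of "cst r" p] keys_cst[of r] by force

lemma keys_lin:
  "(\<And>m. m \<in> Poly_Mapping.keys p \<Longrightarrow> Poly_Mapping.keys (g m) \<subseteq> A) \<Longrightarrow> Poly_Mapping.keys (lin g p) \<subseteq> A"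
  unfolding lin_def by (intro keys_sum_subset) (meson keys_mult_cst order_trans)

text \<open>Factors may be exchanged only when one of them is central. Monomials always are; a
  constant \<open>cst r\<close> is when \<open>r\<close> is central in R.\<close>

definition central :: "'a::ring_1 \<Rightarrow> bool"
  where "central p \<longleftrightarrow> (\<forall>q. p * q = q * p)"

lemma centralD: "central p \<Longrightarrow> p * q = q * p"
  by (simp add: central_def)

lemma central_left_commute: "central p \<Longrightarrow> p * (q * r) = q * (p * r)"
  by (metis centralD mult.assoc)

lemma central_basic: "central 0" "central 1"
  by (simp_all add: central_def)

lemma central_add: "central p \<Longrightarrow> central q \<Longrightarrow> central (p + q)"
  by (simp add: central_def distrib_left distrib_right)

lemma central_uminus: "central p \<Longrightarrow> central (- p)"
  by (simp add: central_def)

lemma central_diff: "central p \<Longrightarrow> central q \<Longrightarrow> central (p - q)"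
  using central_add[of p "- q"] by (simp add: central_uminus)

lemma central_mult: "central p \<Longrightarrow> central q \<Longrightarrow> central (p * q)"
  unfolding central_def by (metis mult.assoc)

lemma central_power: "central p \<Longrightarrow> central (p ^ k)"
  by (induction k) (auto intro: central_mult central_basic)

lemma central_sum: "(\<And>x. x \<in> I \<Longrightarrow> central (f x)) \<Longrightarrow> central (\<Sum>x\<in>I. f x)"
  by (induction I rule: infinite_finite_induct) (auto intro: central_add central_basic)

lemma central_mon: "central (mon m)"
  unfolding central_def
proof
  fix q :: "'a mpol"
  show "mon m * q = q * mon m"
    by (induction q rule: mpol_induct_all)
       (simp_all add: mon_def mult_single add.commute distrib_left distrib_right)
qed

lemma central_polyX: "central (polyX i)"
  unfolding polyX_def by (rule central_mon)

lemma central_cst: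
  fixes r :: "'a::ring_1"
  assumes "central r" shows "central (cst r)"
  unfolding central_def
proof
  fix q :: "'a mpol"
  show "cst r * q = q * cst r"
    by (induction q rule: mpol_induct_all)
       (simp_all add: cst_def mult_single centralD[OF assms] distrib_left distrib_right)
qed

lemmas central_intros = central_basic central_add central_uminus central_diff central_mult
  central_power central_sum central_mon central_polyX central_cst

section \<open>Closure properties of the polynomials in X_1, ..., X_n\<close>

lemma polys_basic: "0 \<in> polys n" "1 \<in> polys n" "cst r \<in> polys n"
  using keys_cst[of r] by (auto simp: polys_def)

lemma polys_mon: "Poly_Mapping.keys m \<subseteq> {1..n} \<Longrightarrow> mon m \<in> polys n"
  by (simp add: polys_def)

lemma polys_polyX: "i \<in> {1..n} \<Longrightarrow> polyX i \<in> polys n"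
  by (simp add: polyX_def polys_def)

lemma polys_add: "p \<in> polys n \<Longrightarrow> q \<in> polys n \<Longrightarrow> p + q \<in> polys n"
  using keys_add[of p q] by (auto simp: polys_def)

lemma polys_uminus: "p \<in> polys n \<Longrightarrow> - p \<in> polys n"
  by (simp add: polys_def)

lemma polys_diff: "p \<in> polys n \<Longrightarrow> q \<in> polys n \<Longrightarrow> p - q \<in> polys n"
  using polys_add[of p n "- q"] by (simp add: polys_uminus)

lemma keys_expo_add: "Poly_Mapping.keys (m + m' :: expo) = Poly_Mapping.keys m \<union> Poly_Mapping.keys m'"
  by (auto simp: in_keys_iff lookup_add)

lemma polys_mult: "p \<in> polys n \<Longrightarrow> q \<in> polys n \<Longrightarrow> p * q \<in> polys n"
  using keys_mult[of p q] unfolding polys_def by (fastforce simp: keys_expo_add)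

lemma polys_sum: "(\<And>x. x \<in> I \<Longrightarrow> f x \<in> polys n) \<Longrightarrow> (\<Sum>x\<in>I. f x) \<in> polys n"
  by (induction I rule: infinite_finite_induct) (auto intro: polys_add polys_basic)

lemma polys_power: "p \<in> polys n \<Longrightarrow> p ^ k \<in> polys n"
  by (induction k) (auto intro: polys_mult polys_basic)

lemma polys_mono: "m \<le> n \<Longrightarrow> polys m \<subseteq> polys n"
  by (fastforce simp: polys_def)

lemmas polys_intros = polys_basic polys_mon polys_polyX polys_add polys_uminus polys_diff
  polys_mult polys_sum polys_power

lemma lookup_mult_mon: "Poly_Mapping.lookup (q * mon t) (m + t) = Poly_Mapping.lookup q m"
  by (induction q rule: mpol_induct_all)
     (simp_all add: mon_def mult_single lookup_add lookup_single when_def distrib_right)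

text \<open>R may have zero divisors, so coefficients are compared directly. From q X_j = q X_i, the
  coefficient of q at m equals the one at m with a factor X_i traded for X_j, or 0 if X_i does not
  occur in m; induction on the exponent of X_i finishes.\<close>

lemma polyX_diff_cancel:
  fixes q :: "'a::ring_1 mpol"
  assumes "i \<noteq> j" "q * (polyX j - polyX i) = 0"
  shows "q = 0"
proof -
  let ?e = "\<lambda>i. Poly_Mapping.single i (1::nat)"
  have eq: "q * mon (?e j) = q * mon (?e i)"
    using assms(2) by (simp add: right_diff_distrib polyX_def)
  have "Poly_Mapping.lookup q m = 0" for m
  proof (induction "Poly_Mapping.lookup m i" arbitrary: m)
    case 0
    have "Poly_Mapping.lookup (q * mon (?e i)) (m + ?e j) = 0"
    proof (rule ccontr)
      assume "\<not> ?thesis"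
      then obtain b where "m + ?e j = b + ?e i"
        using keys_mult[of q "mon (?e i)"] by (auto simp: in_keys_iff)
      then have "Poly_Mapping.lookup (m + ?e j) i = Poly_Mapping.lookup (b + ?e i) i" by simp
      then show False using 0 assms(1) by (simp add: lookup_add lookup_single)
    qed
    then show ?case using lookup_mult_mon[of q "?e j" m] by (metis eq)
  next
    case (Suc k)
    \<comment> \<open>The exponent m with one X_i replaced by X_j.\<close>
    define m' where "m' = Poly_Mapping.update i k m + ?e j"
    have "m' + ?e i = m + ?e j"
      unfolding m'_def
      using Suc(2) assms(1)
      by (intro poly_mapping_eqI) (auto simp: lookup_add lookup_single when_def lookup_update)
    moreover have "Poly_Mapping.lookup q m' = 0"
      using assms(1) by (intro Suc(1)) (simp add: m'_def lookup_add lookup_single lookup_update)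
    ultimately show ?case
      using lookup_mult_mon[of q "?e j" m] lookup_mult_mon[of q "?e i" m'] by (metis eq)
  qed
  then show ?thesis by (intro poly_mapping_eqI) simp
qed

subsection \<open>Divided differences\<close>

text \<open>\<open>div_diff c i N\<close> is the divided difference at $X_1, \dots, X_i$ of the polynomial
  $\sum_k c_k Z^{N+i-1-k}$, i.e. $\sum_k c_k h_{N-k}(X_1, \dots, X_i)$ with the complete
  homogeneous symmetric polynomials $h_k$.\<close>

fun div_diff :: "(nat \<Rightarrow> 'a::ring_1 mpol) \<Rightarrow> nat \<Rightarrow> nat \<Rightarrow> 'a mpol" where
  "div_diff c 0 N = c N"
| "div_diff c (Suc i) 0 = c 0"
| "div_diff c (Suc i) (Suc N) = div_diff c i (Suc N) + polyX (Suc i) * div_diff c (Suc i) N"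

lemma div_diff_0 [simp]: "div_diff c i 0 = c 0"
  by (cases i) auto

lemma div_diff_diff: "div_diff (\<lambda>k. c k - c' k) i N = div_diff c i N - div_diff c' i N"
  by (induction c i N rule: div_diff.induct) (simp_all add: right_diff_distrib add_diff_add)

lemma div_diff_polys_le:
  assumes "\<And>k. c k \<in> polys i" shows "j \<le> i \<Longrightarrow> div_diff c j N \<in> polys i"
  using assms by (induction c j N rule: div_diff.induct) (simp_all add: polys_add polys_mult polys_polyX)

lemmas div_diff_polys = div_diff_polys_le[OF _ order_refl]

lemma div_diff_central:
  assumes "\<And>k. central (c k)" shows "central (div_diff c i N)"
  using assms
  by (induction c i N rule: div_diff.induct) (simp_all add: central_add central_mult central_polyX)

text \<open>Unrolls the recursion in the last variable. The coefficient of the top power is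
  \<open>c 0\<close>, which is what later makes the f_i monic.\<close>

lemma div_diff_eq_sum:
  "div_diff c (Suc i) N = (\<Sum>k\<le>N. polyX (Suc i) ^ k * div_diff c i (N - k))"
proof (induction N)
  case (Suc N)
  then show ?case
    by (simp add: sum.atMost_Suc_shift sum_distrib_left mult.assoc del: sum.atMost_Suc)
qed simp

text \<open>Coefficients are indexed from the leading one, so a zero put in front leaves the
  polynomial in Z unchanged and only raises its formal degree by one.\<close>

lemma div_diff_shift:
  "div_diff (\<lambda>k. case k of 0 \<Rightarrow> 0 | Suc l \<Rightarrow> c l) i (Suc N) = div_diff c i N"
proof (induction c i N rule: div_diff.induct)
  case (2 c i)
  have "div_diff (case_nat 0 c) j (Suc 0) = c 0" for j
    by (induction j) simp_all
  then show ?case by simp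
qed simp_all

lemma div_diff_mult: "central x \<Longrightarrow> div_diff (\<lambda>k. x * c k) i N = x * div_diff c i N"
proof (induction c i N rule: div_diff.induct)
  case (3 c i N)
  then show ?case by (simp add: distrib_left central_left_commute[of x])
qed auto

lemma subst_next_lin:
  "subst_next i = lin (\<lambda>m. mon (Poly_Mapping.update i 0 m +
     Poly_Mapping.single (Suc i) (Poly_Mapping.lookup m i)))"
  by (rule ext) (simp add: subst_next_def lin_def mon_mult_cst)

lemma subst_next_add: "subst_next i (p + q) = subst_next i p + subst_next i q"
  by (simp add: subst_next_lin lin_add)

text \<open>Full multiplicativity of the substitution is avoided: this case, additivity and
  \<open>subst_next_fixed\<close> suffice to push it through the recursion of
  \<open>div_diff\<close>.\<close>

lemma subst_next_polyX_mult: "subst_next i (polyX i * p) = polyX (Suc i) * subst_next i p"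
proof (induction p rule: mpol_induct_all)
  case (single m r)
  have "Poly_Mapping.update i 0 (Poly_Mapping.single i 1 + m) +
      Poly_Mapping.single (Suc i) (Suc (Poly_Mapping.lookup m i)) =
    Poly_Mapping.single (Suc i) 1 + (Poly_Mapping.update i 0 m +
      Poly_Mapping.single (Suc i) (Poly_Mapping.lookup m i))"
    by (rule poly_mapping_eqI) (auto simp: lookup_add lookup_single lookup_update when_def)
  then show ?case
    by (simp add: subst_next_lin polyX_def mon_def mult_single lin_single cst_def lookup_add)
qed (simp_all add: subst_next_lin lin_add distrib_left)

lemma subst_next_fixed: "j < i \<Longrightarrow> p \<in> polys j \<Longrightarrow> subst_next i p = p"
proof -
  assume "j < i" "p \<in> polys j"
  then have "Poly_Mapping.keys p \<subseteq> {m. Poly_Mapping.keys m \<subseteq> {1..j}}"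
    by (auto simp: polys_def)
  then show ?thesis
  proof (induction p rule: mpol_induct)
    case (single m r)
    then have "Poly_Mapping.lookup m i = 0"
      using \<open>j < i\<close> by (fastforce simp: in_keys_iff)
    then have "Poly_Mapping.update i 0 m + Poly_Mapping.single (Suc i) (Poly_Mapping.lookup m i) = m"
      by (intro poly_mapping_eqI) (auto simp: lookup_add lookup_single lookup_update when_def)
    then show ?case by (simp add: subst_next_lin lin_single mon_mult_cst)
  qed (simp_all add: subst_next_lin lin_add)
qed

text \<open>This is the passage from f_i to f_(i+1). The coefficients are constants, so the
  substitution affects only the last variable, and the recursion for \<open>div_diff\<close> reduces
  N by one.\<close>

lemma subst_next_div_diff:
  assumes "\<And>k. c k \<in> polys 0"
  shows "subst_next (Suc j) (div_diff c (Suc j) (Suc N)) - div_diff c (Suc j) (Suc N) =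
    (polyX (Suc (Suc j)) - polyX (Suc j)) * div_diff c (Suc (Suc j)) N"
proof -
  have c: "c k \<in> polys i" for k i
    using assms polys_mono[of 0 i] by auto
  have fix_lower: "subst_next (Suc j) (div_diff c j M) = div_diff c j M" for M
    by (rule subst_next_fixed[of j]) (auto intro: div_diff_polys c)
  have step: "subst_next (Suc j) (div_diff c (Suc j) (Suc M)) =
      div_diff c j (Suc M) + polyX (Suc (Suc j)) * subst_next (Suc j) (div_diff c (Suc j) M)" for M
    by (simp add: subst_next_add fix_lower subst_next_polyX_mult)
  show ?thesis
  proof (induction N)
    case 0
    have "subst_next (Suc j) (c 0) = c 0"
      by (rule subst_next_fixed[OF _ assms]) simp
    then show ?case by (subst step) (simp add: algebra_simps)
  next
    case (Suc N)
    let ?X = "polyX (Suc j)" and ?Y = "polyX (Suc (Suc j))"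
    let ?d = "div_diff c (Suc j)"
    \<comment> \<open>Obtained by adding and subtracting \<open>?Y * ?d (Suc N)\<close>.\<close>
    have "subst_next (Suc j) (?d (Suc (Suc N))) - ?d (Suc (Suc N)) =
      ?Y * (subst_next (Suc j) (?d (Suc N)) - ?d (Suc N)) + (?Y - ?X) * ?d (Suc N)"
      by (subst step) (simp add: algebra_simps)
    also have "\<dots> = (?Y - ?X) * (?Y * div_diff c (Suc (Suc j)) N) + (?Y - ?X) * ?d (Suc N)"
      unfolding Suc
      by (simp only: central_left_commute[OF central_polyX, of "Suc (Suc j)" "?Y - ?X"])
    finally show ?case by (simp add: distrib_left)
  qed
qed

text \<open>Signed coefficient of Z^(n-k) in f, counted from the leading one and continued by 0
  beyond k = n, since \<open>div_diff\<close> takes an infinite sequence.\<close>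

definition f_coeff :: "nat \<Rightarrow> (nat \<Rightarrow> 'a::ring_1) \<Rightarrow> nat \<Rightarrow> 'a mpol"
  where "f_coeff n a k = (if k = 0 then 1 else if k \<le> n then (- 1) ^ k * cst (a k) else 0)"

lemma f_coeff_polys: "f_coeff n a k \<in> polys i"
  by (simp add: f_coeff_def polys_intros)

lemma div_diff_f_coeff_1: "div_diff (f_coeff n a) 1 n = f_at n a (polyX 1)"
proof -
  have "div_diff (f_coeff n a) 1 n = (\<Sum>k\<le>n. polyX 1 ^ (n - k) * f_coeff n a k)"
    unfolding One_nat_def div_diff_eq_sum
    by (rule sum.reindex_bij_witness[of _ "\<lambda>k. n - k" "\<lambda>k. n - k"]) auto
  also have "{..n} = insert 0 {1..n}" by auto
  also have "(\<Sum>k\<in>insert 0 {1..n}. polyX 1 ^ (n - k) * f_coeff n a k) = f_at n a (polyX 1)"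
    unfolding f_at_def
    by (auto simp: f_coeff_def intro!: sum.cong centralD central_intros)
  finally show ?thesis .
qed

text \<open>Discharges the definite description: \<open>subst_next_div_diff\<close> gives a
  quotient, \<open>polyX_diff_cancel\<close> its uniqueness. The last argument is the degree n-(i-1)
  of f_i in X_i.\<close>

lemma f_seq_eq_div_diff: "i \<in> {1..n} \<Longrightarrow> f_seq n a i = div_diff (f_coeff n a) i (Suc n - i)"
proof (induction n a i rule: f_seq.induct)
  case (2 n a)
  then show ?case using div_diff_f_coeff_1[of n a] by simp
next
  case (3 n a j)
  let ?i = "Suc j" and ?g = "div_diff (f_coeff n a) (Suc (Suc j)) (Suc n - Suc (Suc j))"
  let ?D = "polyX (Suc ?i) - polyX ?i :: 'a mpol"
  have "Suc n - ?i = Suc (Suc n - Suc (Suc j))" using 3 by auto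
  then have f: "f_seq n a ?i = div_diff (f_coeff n a) ?i (Suc (Suc n - Suc (Suc j)))"
    using 3 by auto
  have eq: "?g * ?D = subst_next ?i (f_seq n a ?i) - f_seq n a ?i"
    unfolding f by (subst subst_next_div_diff[OF f_coeff_polys])
      (rule centralD[symmetric], intro central_intros)
  have "f_seq n a (Suc (Suc j)) = (THE q. q \<in> polys (Suc ?i) \<and> q * ?D = ?g * ?D)"
    by (simp only: f_seq.simps Let_def eq)
  also have "\<dots> = ?g"
  proof (rule the_equality)
    fix q assume "q \<in> polys (Suc ?i) \<and> q * ?D = ?g * ?D"
    then have "(q - ?g) * ?D = 0" by (simp add: left_diff_distrib)
    then show "q = ?g" using polyX_diff_cancel[of ?i "Suc ?i" "q - ?g"] by simp
  qed (auto intro: div_diff_polys f_coeff_polys)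
  finally show ?case .
qed auto

section \<open>Elementary symmetric polynomials\<close>

lemma elem_sym_0 [simp]: "elem_sym n 0 = 1"
proof -
  have "S \<subseteq> {1..n} \<and> card S = 0 \<longleftrightarrow> S = {}" for S
    by (metis card.empty card_0_eq empty_subsetI finite_atLeastAtMost finite_subset)
  then show ?thesis by (simp add: elem_sym_def)
qed

lemma elem_sym_gt: "n < k \<Longrightarrow> elem_sym n k = 0"
proof -
  assume "n < k"
  have "\<not> (S \<subseteq> {1..n} \<and> card S = k)" for S
    using card_mono[of "{1..n}" S] \<open>n < k\<close> by auto
  then have "{S. S \<subseteq> {1..n} \<and> card S = k} = {}" by blast
  then show ?thesis by (simp only: elem_sym_def sum.empty)
qed

lemma elem_sym_Suc:
  "elem_sym (Suc n) (Suc k) = elem_sym n (Suc k) + polyX (Suc n) * elem_sym n k"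
proof -
  let ?A = "{S. S \<subseteq> {1..n} \<and> card S = Suc k}" and ?B = "{S. S \<subseteq> {1..n} \<and> card S = k}"
  let ?f = "\<lambda>S. mon (\<Sum>i\<in>S. Poly_Mapping.single i 1) :: 'a mpol"
  have notin: "Suc n \<notin> S" "finite S" if "S \<subseteq> {1..n}" for S
    using that finite_subset[OF that] by auto
  have "S \<in> ?A \<union> insert (Suc n) ` ?B" if S: "S \<subseteq> {1..Suc n}" "card S = Suc k" for S
  proof (cases "Suc n \<in> S")
    case True
    then have "S = insert (Suc n) (S - {Suc n})" "card (S - {Suc n}) = k"
      "S - {Suc n} \<subseteq> {1..n}"
      using S by (auto simp: le_Suc_eq)
    then show ?thesis by blast
  next
    case False
    then have "S \<subseteq> {1..n}" using S(1) by (auto simp: le_Suc_eq subset_iff)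
    then show ?thesis using S by simp
  qed
  moreover have "S \<subseteq> {1..Suc n} \<and> card S = Suc k" if "S \<in> ?A \<union> insert (Suc n) ` ?B" for S
    using that by (auto simp: notin)
  ultimately have "{S. S \<subseteq> {1..Suc n} \<and> card S = Suc k} = ?A \<union> insert (Suc n) ` ?B"
    by blast
  moreover have "?A \<inter> insert (Suc n) ` ?B = {}" by auto
  moreover have "inj_on (insert (Suc n)) ?B"
    by (rule inj_onI) (metis (mono_tags, lifting) insert_ident mem_Collect_eq notin(1))
  ultimately have "elem_sym (Suc n) (Suc k) = (\<Sum>S\<in>?A. ?f S) + (\<Sum>S\<in>?B. ?f (insert (Suc n) S))"
    unfolding elem_sym_def by (simp add: sum.union_disjoint sum.reindex)
  also have "(\<Sum>S\<in>?B. ?f (insert (Suc n) S)) = (\<Sum>S\<in>?B. polyX (Suc n) * ?f S)"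
    by (rule sum.cong) (auto simp: notin mon_add polyX_def)
  finally show ?thesis by (simp add: elem_sym_def sum_distrib_left)
qed

lemma elem_sym_central: "central (elem_sym n k)"
  unfolding elem_sym_def by (intro central_intros)

lemma elem_sym_polys: "elem_sym n k \<in> polys n"
  unfolding elem_sym_def
proof (intro polys_sum polys_mon)
  fix S assume "S \<in> {S. S \<subseteq> {1..n} \<and> card S = k}"
  then show "Poly_Mapping.keys (\<Sum>i\<in>S. Poly_Mapping.single i (1::nat)) \<subseteq> {1..n}"
    by (intro keys_sum_subset) auto
qed

text \<open>The signed entries are the coefficients of the product of all Z - X_j with j \<le> n.
  For i > 0 the divided difference is thus that of Z^(N+i-1-n) times this product, which vanishes at
  X_1, ..., X_i. The induction on n splits off the factor Z - X_(n+1).\<close>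

lemma div_diff_elem_sym:
  "i \<le> n \<Longrightarrow> n < N + i \<Longrightarrow> div_diff (\<lambda>k. (- 1) ^ k * elem_sym n k) i N = (0 :: 'a::ring_1 mpol)"
proof (induction n arbitrary: i N)
  case 0
  then show ?case by (simp add: elem_sym_gt)
next
  case (Suc n)
  obtain M where N: "N = Suc M" using Suc.prems by (cases N) auto
  let ?e = "\<lambda>n k. (- 1) ^ k * elem_sym n k :: 'a mpol" and ?X = "polyX (Suc n) :: 'a mpol"
  let ?s = "\<lambda>k. case k of 0 \<Rightarrow> 0 | Suc l \<Rightarrow> ?e n l"
  have e: "?e (Suc n) k = ?e n k - ?X * ?s k" for k
  proof (cases k)
    case (Suc l)
    have "central ((- 1) ^ l :: 'a mpol)" by (intro central_intros)
    then have "(- 1) ^ l * (?X * elem_sym n l) = ?X * ?e n l"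
      by (rule central_left_commute)
    then show ?thesis
      by (simp add: Suc elem_sym_Suc distrib_left)
  qed simp
  have rec: "div_diff (?e (Suc n)) i N = div_diff (?e n) i N - ?X * div_diff (?e n) i M"
    unfolding e div_diff_diff div_diff_mult[OF central_polyX] N div_diff_shift ..
  show ?case
  proof (cases "i \<le> n")
    case True
    then show ?thesis
      unfolding rec using Suc.IH[of i N] Suc.IH[of i M] Suc.prems by (simp add: N)
  next
    case False
    \<comment> \<open>Here the recursion of \<open>div_diff\<close> adds exactly the term with
      X_(n+1) that \<open>rec\<close> subtracts, leaving the case of n points, covered by the
      induction hypothesis.\<close>
    then have "i = Suc n" using Suc.prems by simp
    then show ?thesis
      unfolding rec using Suc.IH[of n N] by (simp add: N)
  qed
qed

subsection \<open>Division by a monic polynomial\<close>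

lemma mon_split:
  "mon m = mon (Poly_Mapping.update i 0 m) * polyX i ^ Poly_Mapping.lookup m i"
proof -
  have "m = Poly_Mapping.update i 0 m + Poly_Mapping.single i (Poly_Mapping.lookup m i)"
    by (rule poly_mapping_eqI) (auto simp: lookup_add lookup_single lookup_update when_def)
  then show ?thesis by (metis mon_add mon_single)
qed

lemma polys_lookup_0: "p \<in> polys j \<Longrightarrow> j < i \<Longrightarrow> Poly_Mapping.keys p \<subseteq> {m. Poly_Mapping.lookup m i = 0}"
  by (fastforce simp: polys_def in_keys_iff)

declare sum.cong [fundef_cong]

text \<open>Remainder of X_i^e, found by repeatedly replacing X_i^d by the sum of the b_k X_i^k. The
  congruence rule for sums supplies k < d, so the exponent e - d + k is smaller than e and the
  recursion terminates.\<close>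

fun rem_pow :: "nat \<Rightarrow> nat \<Rightarrow> (nat \<Rightarrow> 'a::ring_1 mpol) \<Rightarrow> nat \<Rightarrow> 'a mpol" where
  "rem_pow i d b e =
    (if e < d then polyX i ^ e else (\<Sum>k<d. b k * rem_pow i d b (e - d + k)))"

declare rem_pow.simps [simp del]

text \<open>\<open>red i d b\<close> is the remainder upon division by $X_i^d - \sum_{k<d} b_k X_i^k$, where $X_i$ does
  not occur in the \<open>b k\<close>.\<close>

definition red :: "nat \<Rightarrow> nat \<Rightarrow> (nat \<Rightarrow> 'a::ring_1 mpol) \<Rightarrow> 'a mpol \<Rightarrow> 'a mpol"
  where "red i d b = lin (\<lambda>m. mon (Poly_Mapping.update i 0 m) * rem_pow i d b (Poly_Mapping.lookup m i))"

lemma red_add: "red i d b (p + q) = red i d b p + red i d b q"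
  by (simp add: red_def lin_add)

lemma red_0: "red i d b 0 = 0"
  by (simp add: red_def)

lemma red_diff: "red i d b (p - q) = red i d b p - red i d b q"
  by (simp add: red_def lin_diff)

lemma red_sum: "red i d b (\<Sum>x\<in>A. f x) = (\<Sum>x\<in>A. red i d b (f x))"
  by (induction A rule: infinite_finite_induct) (simp_all add: red_add red_0)

lemma red_mult_cst: "red i d b (p * cst r) = red i d b p * cst r"
  by (simp add: red_def lin_mult_cst)

lemma update_0_polyX: "Poly_Mapping.update i 0 (Poly_Mapping.single i e) = (0::expo)"
  by (rule poly_mapping_eqI) (auto simp: lookup_single lookup_update)

lemma red_polyX_power: "red i d b (polyX i ^ e) = rem_pow i d b e"
  by (simp add: red_def update_0_polyX flip: mon_single)

context
  fixes b :: "nat \<Rightarrow> 'a::ring_1 mpol" and d :: nat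
  assumes b_central: "\<And>k. central (b k)"
begin

lemma rem_pow_central: "central (rem_pow i d b e)"
proof (induction e rule: less_induct)
  case (less e)
  then show ?case
    by (subst rem_pow.simps) (auto intro!: central_sum central_mult b_central central_power central_polyX)
qed

text \<open>Polynomials free of X_i act as scalars for the division. Left linearity is not
  automatic, as \<open>red\<close> is built right linear.\<close>

lemma red_mult_left:
  assumes "Poly_Mapping.keys q \<subseteq> {m. Poly_Mapping.lookup m i = 0}"
  shows "red i d b (q * p) = q * red i d b p"
  using assms
proof (induction q rule: mpol_induct)
  case (single m r)
  show ?case
  proof (induction p rule: mpol_induct_all)
    case (single m' s)
    let ?c = "mon (Poly_Mapping.update i 0 m') * rem_pow i d b (Poly_Mapping.lookup m' i)"
    have "Poly_Mapping.update i 0 (m + m') = m + Poly_Mapping.update i 0 m'"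
      using \<open>m \<in> _\<close> by (intro poly_mapping_eqI) (auto simp: lookup_add lookup_update)
    then have "red i d b (Poly_Mapping.single m r * Poly_Mapping.single m' s) = mon m * (?c * (cst r * cst s))"
      using \<open>m \<in> _\<close> by (simp add: mult_single red_def lin_single mon_add lookup_add cst_mult mult.assoc)
    \<comment> \<open>The coefficient \<open>r\<close> need not be central; it can pass because the
      remainder \<open>?c\<close> is.\<close>
    also have "\<dots> = mon m * (cst r * (?c * cst s))"
      by (subst central_left_commute[of ?c]) (intro central_mult central_mon rem_pow_central, rule refl)
    also have "\<dots> = Poly_Mapping.single m r * red i d b (Poly_Mapping.single m' s)"
      by (simp add: red_def lin_single mult.assoc flip: mon_mult_cst[of m])
    finally show ?case .
  qed (simp_all add: red_add red_0 distrib_left)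
qed (simp_all add: red_add red_0 distrib_right)

text \<open>By linearity only multiples by powers of X_i matter, and for those the claim is the
  defining recursion of \<open>rem_pow\<close>.\<close>

lemma red_monic_mult:
  assumes free: "\<And>k. Poly_Mapping.keys (b k) \<subseteq> {m. Poly_Mapping.lookup m i = 0}"
  shows "red i d b ((polyX i ^ d - (\<Sum>k<d. b k * polyX i ^ k)) * p) = 0"
proof -
  let ?g = "polyX i ^ d - (\<Sum>k<d. b k * polyX i ^ k)"
  have g: "central ?g" by (intro central_intros b_central)
  have pow: "red i d b (?g * polyX i ^ e) = 0" for e
  proof -
    have "?g * polyX i ^ e = polyX i ^ (d + e) - (\<Sum>k<d. b k * polyX i ^ (k + e))"
      by (simp add: left_diff_distrib sum_distrib_right mult.assoc power_add)
    moreover have "rem_pow i d b (d + e) = (\<Sum>k<d. b k * rem_pow i d b (k + e))"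
      by (subst rem_pow.simps) (simp add: add.commute)
    ultimately show ?thesis
      by (simp add: red_diff red_sum red_mult_left[OF free] red_polyX_power)
  qed
  show ?thesis
  proof (induction p rule: mpol_induct_all)
    case (single m r)
    let ?m = "mon (Poly_Mapping.update i 0 m) :: 'a mpol" and ?e = "Poly_Mapping.lookup m i"
    have "?g * Poly_Mapping.single m r = ?m * (?g * polyX i ^ ?e) * cst r"
      by (simp only: mon_mult_cst[symmetric] mon_split[of m i] mult.assoc central_left_commute[OF g, of ?m])
    moreover have "Poly_Mapping.keys ?m \<subseteq> {m. Poly_Mapping.lookup m i = 0}"
      by (simp add: lookup_update)
    from red_mult_left[OF this] have "red i d b (?m * (?g * polyX i ^ ?e)) = 0"
      by (simp only: pow) simp
    ultimately show ?case by (simp only: red_mult_cst) simp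
  qed (simp_all add: red_add red_0 distrib_left)
qed

lemma red_fixed:
  assumes "Poly_Mapping.keys p \<subseteq> {m. Poly_Mapping.lookup m i < d}"
  shows "red i d b p = p"
  using assms
proof (induction p rule: mpol_induct)
  case (single m r)
  then show ?case
    by (simp add: red_def lin_single rem_pow.simps mon_mult_cst flip: mon_split)
qed (simp_all add: red_add red_0)

text \<open>The replacement brings in only earlier variables, so a later division never disturbs the
  exponents of variables already treated.\<close>

lemma keys_rem_pow:
  assumes "\<And>k. b k \<in> polys j" and "0 < d"
  shows "Poly_Mapping.keys (rem_pow (Suc j) d b e) \<subseteq>
    {m. Poly_Mapping.keys m \<subseteq> {1..Suc j} \<and> Poly_Mapping.lookup m (Suc j) < d}"
    (is "_ \<subseteq> ?A")
proof (induction e rule: less_induct)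
  case (less e)
  show ?case
  proof (cases "e < d")
    case True
    then show ?thesis
      by (subst rem_pow.simps) (auto simp: lookup_single split: if_splits simp flip: mon_single)
  next
    case False
    have "Poly_Mapping.keys (b k * rem_pow (Suc j) d b (e - d + k)) \<subseteq> ?A" if "k < d" for k
    proof
      fix m assume "m \<in> Poly_Mapping.keys (b k * rem_pow (Suc j) d b (e - d + k))"
      then obtain u v where uv: "m = u + v" "u \<in> Poly_Mapping.keys (b k)"
          "v \<in> Poly_Mapping.keys (rem_pow (Suc j) d b (e - d + k))"
        using keys_mult by blast
      have "Poly_Mapping.keys u \<subseteq> {1..j}" "Poly_Mapping.lookup u (Suc j) = 0"
        using assms(1)[of k] uv(2) polys_lookup_0[of "b k" j "Suc j"] by (auto simp: polys_def)
      moreover have "v \<in> ?A"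
        using less[of "e - d + k", THEN subsetD, of v] that False uv(3) by simp
      ultimately show "m \<in> ?A"
        unfolding uv(1) by (auto simp: keys_expo_add lookup_add)
    qed
    then show ?thesis
      using False by (subst rem_pow.simps) (auto intro!: keys_sum_subset)
  qed
qed

end

section \<open>The polynomial ring and the ideal I_f\<close>

lemma ring_poly_ring: "ring (poly_ring n :: 'a::ring_1 mpol ring)"
proof (rule ringI)
  show "abelian_group (poly_ring n :: 'a mpol ring)"
  proof (rule abelian_groupI)
    fix x :: "'a mpol" assume "x \<in> carrier (poly_ring n)"
    then show "\<exists>y\<in>carrier (poly_ring n). y \<oplus>\<^bsub>poly_ring n\<^esub> x = \<zero>\<^bsub>poly_ring n\<^esub>"
      by (intro bexI[of _ "- x"]) (auto simp: poly_ring_def polys_uminus)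
  qed (auto simp: poly_ring_def polys_intros add.assoc add.commute)
  show "monoid (poly_ring n :: 'a mpol ring)"
    by (rule monoidI) (auto simp: poly_ring_def polys_intros mult.assoc)
qed (auto simp: poly_ring_def distrib_left distrib_right)

lemma ideal_poly_ringI:
  assumes "I \<subseteq> polys n" "0 \<in> I" "\<And>x y. x \<in> I \<Longrightarrow> y \<in> I \<Longrightarrow> x + y \<in> I"
    and "\<And>x p. x \<in> I \<Longrightarrow> p \<in> polys n \<Longrightarrow> p * x \<in> I" "\<And>x p. x \<in> I \<Longrightarrow> p \<in> polys n \<Longrightarrow> x * p \<in> I"
  shows "ideal I (poly_ring n :: 'a::ring_1 mpol ring)"
proof (rule idealI[OF ring_poly_ring])
  interpret ring "poly_ring n :: 'a mpol ring" by (rule ring_poly_ring)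
  have inv: "- x \<in> I \<and> \<ominus>\<^bsub>poly_ring n\<^esub> x = - x" if "x \<in> I" for x
  proof
    show "- x \<in> I" using assms(4)[OF that polys_uminus[OF polys_basic(2)]] by simp
    show "\<ominus>\<^bsub>poly_ring n\<^esub> x = - x"
      using that assms(1) by (intro minus_equality) (auto simp: poly_ring_def polys_uminus)
  qed
  show "subgroup I (add_monoid (poly_ring n :: 'a mpol ring))"
    using assms inv by (intro add.subgroupI) (auto simp: poly_ring_def)
qed (use assms in \<open>auto simp: poly_ring_def\<close>)

lemma elem_sym_generators:
  "(\<lambda>k. elem_sym n k - cst (a k)) ` {1..n} \<subseteq> carrier (poly_ring n)"
  unfolding poly_ring_def by (auto intro!: polys_diff elem_sym_polys polys_basic)

lemma ideal_ideal_f: "ideal (ideal_f n a) (poly_ring n)"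
  unfolding ideal_f_def by (rule ring.genideal_ideal[OF ring_poly_ring elem_sym_generators])

lemma ideal_f_generator: "k \<in> {1..n} \<Longrightarrow> elem_sym n k - cst (a k) \<in> ideal_f n a"
  unfolding ideal_f_def
  by (rule subsetD[OF ring.genideal_self[OF ring_poly_ring elem_sym_generators]]) (rule imageI)

lemma ideal_f_closed:
  shows ideal_f_polys: "x \<in> ideal_f n a \<Longrightarrow> x \<in> polys n"
    and ideal_f_0: "0 \<in> ideal_f n a"
    and ideal_f_add: "x \<in> ideal_f n a \<Longrightarrow> y \<in> ideal_f n a \<Longrightarrow> x + y \<in> ideal_f n a"
    and ideal_f_mult_left: "x \<in> ideal_f n a \<Longrightarrow> p \<in> polys n \<Longrightarrow> p * x \<in> ideal_f n a"
    and ideal_f_mult_right: "x \<in> ideal_f n a \<Longrightarrow> p \<in> polys n \<Longrightarrow> x * p \<in> ideal_f n a"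
proof -
  interpret ideal "ideal_f n a" "poly_ring n" by (rule ideal_ideal_f)
  show "x \<in> ideal_f n a \<Longrightarrow> x \<in> polys n" using Icarr by (simp add: poly_ring_def)
  show "0 \<in> ideal_f n a" using additive_subgroup.zero_closed[OF is_additive_subgroup] by (simp add: poly_ring_def)
  show "x \<in> ideal_f n a \<Longrightarrow> y \<in> ideal_f n a \<Longrightarrow> x + y \<in> ideal_f n a"
    using additive_subgroup.a_closed[OF is_additive_subgroup] by (simp add: poly_ring_def)
  show "x \<in> ideal_f n a \<Longrightarrow> p \<in> polys n \<Longrightarrow> p * x \<in> ideal_f n a"
    "x \<in> ideal_f n a \<Longrightarrow> p \<in> polys n \<Longrightarrow> x * p \<in> ideal_f n a"
    using I_l_closed I_r_closed by (simp_all add: poly_ring_def)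
qed

lemma ideal_f_uminus: "x \<in> ideal_f n a \<Longrightarrow> - x \<in> ideal_f n a"
  using ideal_f_mult_left[of x n a "- 1"] by (simp add: polys_uminus polys_basic)

lemma ideal_f_sum: "(\<And>x. x \<in> A \<Longrightarrow> f x \<in> ideal_f n a) \<Longrightarrow> (\<Sum>x\<in>A. f x) \<in> ideal_f n a"
  by (induction A rule: infinite_finite_induct) (auto intro: ideal_f_0 ideal_f_add)

subsection \<open>The normal form\<close>

locale central_coeffs =
  fixes n :: nat and a :: "nat \<Rightarrow> 'a::ring_1"
  assumes a_central: "k \<in> {1..n} \<Longrightarrow> central (a k)"
begin

text \<open>For j < n, \<open>F (Suc j) (n - j)\<close> is f_(j+1).\<close>

abbreviation F :: "nat \<Rightarrow> nat \<Rightarrow> 'a mpol"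
  where "F \<equiv> div_diff (f_coeff n a)"

lemma f_coeff_central: "central (f_coeff n a k)"
  using a_central[of k] by (auto simp: f_coeff_def intro!: central_intros)

lemma F_central: "central (F i N)"
  by (intro div_diff_central f_coeff_central)

lemma F_polys: "F i N \<in> polys i"
  by (intro div_diff_polys f_coeff_polys)

text \<open>For k < n - j this is minus the coefficient of X_(j+1)^k in f_(j+1), i.e. the h_k from
  the definition of L_{Y_(j+1)} when j > 0.\<close>

definition red_coeff :: "nat \<Rightarrow> nat \<Rightarrow> 'a mpol"
  where "red_coeff j k = - F j (n - j - k)"

lemma red_coeff_central: "central (red_coeff j k)"
  unfolding red_coeff_def by (intro central_uminus F_central)

lemma red_coeff_polys: "red_coeff j k \<in> polys j"
  unfolding red_coeff_def by (intro polys_uminus F_polys)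

lemma red_coeff_free: "Poly_Mapping.keys (red_coeff j k) \<subseteq> {m. Poly_Mapping.lookup m (Suc j) = 0}"
  using polys_lookup_0[OF red_coeff_polys] by simp

lemma F_monic:
  "F (Suc j) (n - j) =
    polyX (Suc j) ^ (n - j) - (\<Sum>k<n - j. red_coeff j k * polyX (Suc j) ^ k)"
proof -
  have "F (Suc j) (n - j) = (\<Sum>k<n - j. polyX (Suc j) ^ k * F j (n - j - k)) + polyX (Suc j) ^ (n - j)"
    by (simp add: div_diff_eq_sum f_coeff_def flip: lessThan_Suc_atMost)
  moreover have "polyX (Suc j) ^ k * F j (n - j - k) = - (red_coeff j k * polyX (Suc j) ^ k)" for k
    using centralD[OF F_central] by (simp add: red_coeff_def)
  ultimately show ?thesis by (simp add: sum_negf)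
qed

definition red_step :: "nat \<Rightarrow> 'a mpol \<Rightarrow> 'a mpol"
  where "red_step j = red (Suc j) (n - j) (red_coeff j)"

text \<open>\<open>nf i\<close> divides by f_i first and by f_1 last; \<open>red_step j\<close>
  treats X_(j+1).\<close>

fun nf :: "nat \<Rightarrow> 'a mpol \<Rightarrow> 'a mpol" where
  "nf 0 p = p"
| "nf (Suc j) p = nf j (red_step j p)"

lemma nf_add: "nf i (p + q) = nf i p + nf i q"
  by (induction i arbitrary: p q) (simp_all add: red_step_def red_add)

lemma nf_0 [simp]: "nf i 0 = 0"
  by (induction i) (simp_all add: red_step_def red_0)

lemma nf_diff: "nf i (p - q) = nf i p - nf i q"
  using nf_add[of i "p - q" q] by simp

lemma nf_sum: "nf i (\<Sum>x\<in>A. f x) = (\<Sum>x\<in>A. nf i (f x))"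
  by (induction A rule: infinite_finite_induct) (simp_all add: nf_add)

lemma nf_mult_cst: "nf i (p * cst r) = nf i p * cst r"
  by (induction i arbitrary: p) (simp_all add: red_step_def red_mult_cst)

lemma red_step_mult_left:
  "Poly_Mapping.keys q \<subseteq> {m. Poly_Mapping.lookup m (Suc j) = 0} \<Longrightarrow> red_step j (q * p) = q * red_step j p"
  unfolding red_step_def by (rule red_mult_left) (rule red_coeff_central)

lemma nf_cst_mult: "nf i (cst r * p) = cst r * nf i p"
proof (induction i arbitrary: p)
  case (Suc i)
  have "red_step i (cst r * p) = cst r * red_step i p"
    using keys_cst[of r] by (intro red_step_mult_left) auto
  then show ?case using Suc by simp
qed simp

text \<open>Divisions in later variables treat f_(j+1) as a scalar, since these do not occur in it;
  the division by f_(j+1) itself then gives 0.\<close>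

lemma nf_F_mult: "j < i \<Longrightarrow> nf i (F (Suc j) (n - j) * p) = 0"
proof (induction i arbitrary: p)
  case (Suc i)
  show ?case
  proof (cases "j = i")
    case True
    then show ?thesis
      by (simp add: F_monic red_step_def red_monic_mult[OF red_coeff_central red_coeff_free])
  next
    case False
    then have "j < i" using Suc by simp
    moreover from this have "red_step i (F (Suc j) (n - j) * p) = F (Suc j) (n - j) * red_step i p"
      by (intro red_step_mult_left polys_lookup_0[OF F_polys]) simp
    ultimately show ?thesis using Suc by simp
  qed
qed simp

text \<open>Exponents in which the reductions by $f_n, \dots, f_{i+1}$ have already been done.\<close>

definition partial_staircase :: "nat \<Rightarrow> expo set"
  where "partial_staircase i = {m. Poly_Mapping.keys m \<subseteq> {1..n} \<and>
    (\<forall>j\<in>{i<..n}. Poly_Mapping.lookup m j \<le> n - j)}"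

lemma partial_staircase_0: "partial_staircase 0 = staircase n"
  unfolding partial_staircase_def staircase_def by (rule Collect_cong) auto

lemma partial_staircase_n: "Poly_Mapping.keys p \<subseteq> partial_staircase n \<longleftrightarrow> p \<in> polys n"
  by (auto simp: partial_staircase_def polys_def)

lemma keys_red_step:
  assumes "j < n" "Poly_Mapping.keys p \<subseteq> partial_staircase (Suc j)"
  shows "Poly_Mapping.keys (red_step j p) \<subseteq> partial_staircase j"
  unfolding red_step_def red_def
proof (rule keys_lin)
  fix m assume m: "m \<in> Poly_Mapping.keys p"
  let ?u = "Poly_Mapping.update (Suc j) 0 m"
  let ?r = "rem_pow (Suc j) (n - j) (red_coeff j) (Poly_Mapping.lookup m (Suc j))"
  show "Poly_Mapping.keys (mon ?u * ?r) \<subseteq> partial_staircase j"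
  proof
    fix w assume "w \<in> Poly_Mapping.keys (mon ?u * ?r)"
    then obtain v where w: "w = ?u + v" and "v \<in> Poly_Mapping.keys ?r"
      using keys_mult[of "mon ?u" ?r] by auto
    then have v: "Poly_Mapping.keys v \<subseteq> {1..Suc j}" "Poly_Mapping.lookup v (Suc j) < n - j"
      using keys_rem_pow[OF red_coeff_central red_coeff_polys, of "n - j"] \<open>j < n\<close> by fastforce+
    have m': "Poly_Mapping.keys m \<subseteq> {1..n}"
        "\<And>l. Suc j < l \<Longrightarrow> l \<le> n \<Longrightarrow> Poly_Mapping.lookup m l \<le> n - l"
      using m assms(2) by (auto simp: partial_staircase_def)
    have "Poly_Mapping.keys w \<subseteq> {1..n}"
      using v(1) m'(1) \<open>j < n\<close> by (fastforce simp: w keys_expo_add keys_update)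
    moreover have "Poly_Mapping.lookup w l \<le> n - l" if "j < l" "l \<le> n" for l
    proof (cases "l = Suc j")
      case False
      then have "Poly_Mapping.lookup v l = 0"
        using v(1) that by (fastforce simp: in_keys_iff)
      then show ?thesis using False that m'(2)[of l] by (simp add: w lookup_add lookup_update)
    qed (use v(2) in \<open>simp add: w lookup_add lookup_update\<close>)
    ultimately show "w \<in> partial_staircase j" by (auto simp: partial_staircase_def)
  qed
qed

lemma red_step_fixed:
  assumes "j < n" "Poly_Mapping.keys p \<subseteq> staircase n"
  shows "red_step j p = p"
proof -
  have "Poly_Mapping.lookup m (Suc j) < n - j" if "m \<in> staircase n" for m
  proof -
    have "Poly_Mapping.lookup m (Suc j) \<le> n - Suc j"
      using that \<open>j < n\<close> by (simp add: staircase_def)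
    then show ?thesis using \<open>j < n\<close> by simp
  qed
  then show ?thesis
    unfolding red_step_def using assms(2) by (intro red_fixed red_coeff_central) auto
qed

lemma nf_fixed: "i \<le> n \<Longrightarrow> Poly_Mapping.keys p \<subseteq> staircase n \<Longrightarrow> nf i p = p"
  by (induction i) (simp_all add: red_step_fixed)

lemma div_diff_in_ideal:
  assumes "\<And>k. c k \<in> ideal_f n a" shows "i \<le> n \<Longrightarrow> div_diff c i N \<in> ideal_f n a"
  using assms
  by (induction c i N rule: div_diff.induct)
     (simp_all add: ideal_f_add ideal_f_mult_left polys_polyX)

text \<open>As the divided differences of $\prod_j (Z - X_j)$ at $X_1, \dots, X_i$ vanish, those of $f$ agree
  with the divided differences of $f - \prod_j (Z - X_j)$, whose coefficients are generators.\<close>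

definition gen_coeff :: "nat \<Rightarrow> 'a mpol"
  where "gen_coeff k = f_coeff n a k - (- 1) ^ k * elem_sym n k"

lemma F_eq_gen: "j < n \<Longrightarrow> F (Suc j) (n - j) = div_diff gen_coeff (Suc j) (n - j)"
  using div_diff_diff[of "f_coeff n a" "\<lambda>k. (- 1) ^ k * elem_sym n k" "Suc j" "n - j"]
    div_diff_elem_sym[of "Suc j" n "n - j", where 'a = 'a]
  by (simp add: gen_coeff_def[abs_def])

lemma gen_coeff_0: "gen_coeff 0 = 0"
  by (simp add: gen_coeff_def f_coeff_def)

lemma gen_coeff_eq: "k \<in> {1..n} \<Longrightarrow> gen_coeff k = - ((- 1) ^ k * (elem_sym n k - cst (a k)))"
  by (simp add: gen_coeff_def f_coeff_def right_diff_distrib)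

lemma gen_coeff_in_ideal: "gen_coeff k \<in> ideal_f n a"
proof -
  consider "k = 0" | "k \<in> {1..n}" | "n < k" by fastforce
  then show ?thesis
  proof cases
    case 2
    then show ?thesis
      unfolding gen_coeff_eq[OF 2]
      by (intro ideal_f_uminus ideal_f_mult_left ideal_f_generator polys_power polys_uminus polys_basic)
  qed (simp_all add: gen_coeff_0 ideal_f_0, simp add: gen_coeff_def f_coeff_def elem_sym_gt ideal_f_0)
qed

lemma F_in_ideal: "j < n \<Longrightarrow> F (Suc j) (n - j) \<in> ideal_f n a"
  by (simp only: F_eq_gen) (rule div_diff_in_ideal, simp_all add: gen_coeff_in_ideal)

text \<open>Each replacement step subtracts a multiple of f_(j+1), which lies in I_f, and leaves
  smaller powers with coefficients on the left.\<close>

lemma rem_pow_in_ideal: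
  assumes "j < n"
  shows "polyX (Suc j) ^ e - rem_pow (Suc j) (n - j) (red_coeff j) e \<in> ideal_f n a"
proof (induction e rule: less_induct)
  case (less e)
  let ?X = "polyX (Suc j) :: 'a mpol" and ?d = "n - j" and ?b = "red_coeff j"
  show ?case
  proof (cases "e < ?d")
    case False
    let ?e = "e - ?d"
    have X: "?X ^ k \<in> polys n" for k
      using assms by (intro polys_power polys_polyX) simp
    have b: "?b k \<in> polys n" for k
      using red_coeff_polys[of j k] polys_mono[of j n] assms by auto
    have "?X ^ e = ?X ^ ?e * ?X ^ ?d" using False by (simp flip: power_add)
    also have "\<dots> = ?X ^ ?e * (F (Suc j) ?d + (\<Sum>k<?d. ?b k * ?X ^ k))"
      by (simp add: F_monic)
    also have "\<dots> = ?X ^ ?e * F (Suc j) ?d + (\<Sum>k<?d. ?b k * ?X ^ (?e + k))"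
      by (simp add: distrib_left sum_distrib_left power_add
          central_left_commute[OF central_power[OF central_polyX]])
    finally have "?X ^ e - rem_pow (Suc j) ?d ?b e = ?X ^ ?e * F (Suc j) ?d +
        (\<Sum>k<?d. ?b k * (?X ^ (?e + k) - rem_pow (Suc j) ?d ?b (?e + k)))"
      using False by (subst rem_pow.simps) (simp add: right_diff_distrib sum_subtractf)
    also have "\<dots> \<in> ideal_f n a"
    proof (rule ideal_f_add)
      show "?X ^ ?e * F (Suc j) ?d \<in> ideal_f n a"
        by (rule ideal_f_mult_left[OF F_in_ideal[OF assms] X])
      show "(\<Sum>k<?d. ?b k * (?X ^ (?e + k) - rem_pow (Suc j) ?d ?b (?e + k))) \<in> ideal_f n a"
      proof (rule ideal_f_sum, rule ideal_f_mult_left[OF less b])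
        fix k assume "k \<in> {..<?d}"
        then show "?e + k < e" using False by simp
      qed
    qed
    finally show ?thesis .
  qed (subst rem_pow.simps, simp add: ideal_f_0)
qed

lemma red_step_in_ideal:
  assumes "j < n" "p \<in> polys n"
  shows "p - red_step j p \<in> ideal_f n a"
proof -
  have "Poly_Mapping.keys p \<subseteq> {m. Poly_Mapping.keys m \<subseteq> {1..n}}"
    using assms(2) by (auto simp: polys_def)
  then show ?thesis
  proof (induction p rule: mpol_induct)
    case (single m r)
    let ?u = "mon (Poly_Mapping.update (Suc j) 0 m) :: 'a mpol" and ?e = "Poly_Mapping.lookup m (Suc j)"
    have "Poly_Mapping.single m r - red_step j (Poly_Mapping.single m r) =
        ?u * (polyX (Suc j) ^ ?e - rem_pow (Suc j) (n - j) (red_coeff j) ?e) * cst r"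
      by (simp add: red_step_def red_def lin_mult_cst right_diff_distrib left_diff_distrib
          flip: mon_mult_cst mon_split)
    also have "\<dots> \<in> ideal_f n a"
      using single assms(1)
      by (intro ideal_f_mult_left ideal_f_mult_right rem_pow_in_ideal polys_mon polys_basic)
        (auto simp: keys_update)
    finally show ?case .
  next
    case (add p q)
    then show ?case
      using ideal_f_add[OF add] by (simp add: red_step_def red_add algebra_simps)
  qed (simp add: red_step_def red_0 ideal_f_0)
qed

lemma partial_staircase_polys: "Poly_Mapping.keys p \<subseteq> partial_staircase i \<Longrightarrow> p \<in> polys n"
  by (auto simp: partial_staircase_def polys_def)

lemma nf_partial:
  assumes "i \<le> n" "Poly_Mapping.keys p \<subseteq> partial_staircase i"
  shows "Poly_Mapping.keys (nf i p) \<subseteq> staircase n \<and> p - nf i p \<in> ideal_f n a"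
  using assms
proof (induction i arbitrary: p)
  case 0
  then show ?case by (simp add: partial_staircase_0 ideal_f_0)
next
  case (Suc i)
  have "Poly_Mapping.keys (red_step i p) \<subseteq> partial_staircase i"
    using Suc.prems by (intro keys_red_step) auto
  then have "Poly_Mapping.keys (nf i (red_step i p)) \<subseteq> staircase n"
    "red_step i p - nf i (red_step i p) \<in> ideal_f n a"
    using Suc by auto
  moreover have "p - red_step i p \<in> ideal_f n a"
    using Suc.prems partial_staircase_polys by (intro red_step_in_ideal) auto
  ultimately show ?case
    using ideal_f_add by fastforce
qed

lemma keys_nf: "p \<in> polys n \<Longrightarrow> Poly_Mapping.keys (nf n p) \<subseteq> staircase n"
  and nf_in_ideal: "p \<in> polys n \<Longrightarrow> p - nf n p \<in> ideal_f n a"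
  using nf_partial[of n p] by (simp_all add: partial_staircase_n)

text \<open>The equations expressing the $f_i$ through the generators form a unitriangular system, so they
  can be solved for the generators.\<close>

lemma nf_gen_coeff_mult: "N \<le> n \<Longrightarrow> nf n (gen_coeff N * p) = 0"
proof (induction N arbitrary: p rule: less_induct)
  case (less N)
  \<comment> \<open>Only \<open>gen_coeff k\<close> with k \<le> M < N enter here, all killed by the
    induction hypothesis.\<close>
  have lower: "nf n (div_diff gen_coeff i M * q) = 0" if "M < N" for i M q
    using that
  proof (induction gen_coeff i M arbitrary: q rule: div_diff.induct)
    case (3 i M)
    have "div_diff gen_coeff (Suc i) (Suc M) * q =
        div_diff gen_coeff i (Suc M) * q + div_diff gen_coeff (Suc i) M * (polyX (Suc i) * q)"
      by (simp add: distrib_right mult.assoc flip: central_left_commute[OF central_polyX])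
    then show ?case using 3 by (simp add: nf_add)
  qed (use less in \<open>simp_all add: gen_coeff_0\<close>)
  \<comment> \<open>Adding a variable changes the divided difference only by a term of smaller
    index, so the number of points is free to choose.\<close>
  have top: "nf n (div_diff gen_coeff i N * p) = nf n (gen_coeff N * p)" for i p
  proof (induction i)
    case (Suc i)
    show ?case
    proof (cases N)
      case (Suc M)
      have "div_diff gen_coeff (Suc i) N * p =
          div_diff gen_coeff i N * p + div_diff gen_coeff (Suc i) M * (polyX (Suc i) * p)"
        by (simp add: Suc distrib_right mult.assoc flip: central_left_commute[OF central_polyX])
      then show ?thesis using lower[of M] \<open>nf n (div_diff gen_coeff i N * p) = _\<close> Suc
        by (simp add: nf_add)
    qed simp
  qed simp
  show ?case
  proof (cases N)
    case (Suc M)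
    \<comment> \<open>With n - N + 1 points the divided difference of index N is f_(n-N+1).\<close>
    then have "nf n (div_diff gen_coeff (Suc (n - N)) N * p) = 0"
      using F_eq_gen[of "n - N"] nf_F_mult[of "n - N" n p] less.prems by simp
    then show ?thesis by (simp only: top)
  qed (simp add: gen_coeff_0)
qed

lemma nf_ideal_f:
  assumes "x \<in> ideal_f n a" shows "nf n x = 0"
proof -
  \<comment> \<open>Vanishing is required for all two-sided multiples, so that this set is visibly
    an ideal; the kernel of \<open>nf n\<close> is not yet known to be one.\<close>
  let ?I = "{x \<in> polys n. \<forall>p q :: 'a mpol. nf n (p * x * q) = 0}"
  have "ideal ?I (poly_ring n)"
  proof (rule ideal_poly_ringI)
    fix x p :: "'a mpol" assume x: "x \<in> ?I" and "p \<in> polys n"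
    moreover have "nf n (q * (p * x) * q') = 0 \<and> nf n (q * (x * p) * q') = 0" for q q'
      using x by (auto simp flip: mult.assoc) (simp add: mult.assoc)
    ultimately show "p * x \<in> ?I" "x * p \<in> ?I" by (auto intro: polys_mult)
  qed (auto simp: distrib_left distrib_right nf_add intro: polys_intros)
  moreover have "elem_sym n k - cst (a k) \<in> ?I" if k: "k \<in> {1..n}" for k
  proof -
    let ?g = "elem_sym n k - cst (a k) :: 'a mpol"
    have "central ?g"
      using a_central[OF k] by (intro central_diff elem_sym_central central_cst)
    have s: "central ((- 1) ^ k :: 'a mpol)" by (intro central_intros)
    have "nf n (p * ?g * q) = 0" for p q
    proof -
      have "p * ?g * q = ?g * (p * q)"
        by (simp only: centralD[OF \<open>central ?g\<close>, of p] flip: mult.assoc)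
      \<comment> \<open>One sign is absorbed into \<open>gen_coeff k\<close>, the other into the
        cofactor.\<close>
      also have "\<dots> = ((- 1) ^ k * (- 1) ^ k) * (?g * (p * q))"
        by (simp add: minus_one_power_iff)
      also have "\<dots> = - (gen_coeff k * ((- 1) ^ k * (p * q)))"
        unfolding gen_coeff_eq[OF k] mult_minus_left minus_minus mult.assoc
        by (simp only: central_left_commute[OF s, of ?g])
      finally show ?thesis using nf_gen_coeff_mult[of k] nf_diff[of n 0] k by simp
    qed
    moreover have "?g \<in> polys n"
      by (intro polys_diff elem_sym_polys polys_basic)
    ultimately show ?thesis by blast
  qed
  ultimately have "ideal_f n a \<subseteq> ?I"
    unfolding ideal_f_def by (intro ring.genideal_minimal[OF ring_poly_ring]) auto
  then have "nf n (1 * x * 1) = 0" using assms by blast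
  then show ?thesis by simp
qed

lemma nf_eq_0_iff: "p \<in> polys n \<Longrightarrow> nf n p = 0 \<longleftrightarrow> p \<in> ideal_f n a"
  using nf_in_ideal[of p] nf_ideal_f[of p] by auto

text \<open>The two arguments differ by p times an element of I_f. This is what makes
  \<open>act\<close> multiplicative.\<close>

lemma nf_mult_nf: "p \<in> polys n \<Longrightarrow> q \<in> polys n \<Longrightarrow> nf n (p * nf n q) = nf n (p * q)"
  using nf_ideal_f[OF ideal_f_mult_left[OF nf_in_ideal]] by (simp add: right_diff_distrib nf_diff)

end

subsection \<open>The endomorphism ring of the right module\<close>

text \<open>Induction over ring generators, suited to homomorphisms and to
  \<open>generate_ring\<close>.\<close>

lemma polys_induct [consumes 1, case_names cst polyX add mult]:
  fixes p :: "'a::ring_1 mpol"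
  assumes "p \<in> polys n"
    and cst: "\<And>r. P (cst r)" and X: "\<And>i. i \<in> {1..n} \<Longrightarrow> P (polyX i)"
    and add: "\<And>p q. p \<in> polys n \<Longrightarrow> q \<in> polys n \<Longrightarrow> P p \<Longrightarrow> P q \<Longrightarrow> P (p + q)"
    and mult: "\<And>p q. p \<in> polys n \<Longrightarrow> q \<in> polys n \<Longrightarrow> P p \<Longrightarrow> P q \<Longrightarrow> P (p * q)"
  shows "P p"
proof -
  have one: "P 1" using cst[of 1] by simp
  have power: "P (polyX i ^ k)" if "i \<in> {1..n}" for i k
    by (induction k) (auto intro!: one mult X polys_power polys_polyX that)
  have mon: "Poly_Mapping.keys m \<subseteq> {1..n} \<Longrightarrow> P (mon m)" for m
  proof (induction m rule: Poly_Mapping.update_induct)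
    case (update m i k)
    have "Poly_Mapping.update i k m = m + Poly_Mapping.single i k"
      using update(1) by (intro poly_mapping_eqI) (auto simp: lookup_add lookup_single lookup_update in_keys_iff)
    moreover have "i \<in> {1..n}" "Poly_Mapping.keys m \<subseteq> {1..n}"
      using update by (auto simp: keys_update)
    ultimately show ?case
      using update by (auto simp: mon_add mon_single intro!: mult power polys_intros)
  qed (simp add: one)
  have "Poly_Mapping.keys p \<subseteq> {m. Poly_Mapping.keys m \<subseteq> {1..n}}"
    using assms(1) by (auto simp: polys_def)
  then have "p \<in> polys n \<and> P p"
  proof (induction p rule: mpol_induct)
    case zero
    then show ?case using cst[of 0] by (simp add: polys_basic)
  next
    case (single m r)
    then show ?case
      by (simp flip: cst_mult_mon) (auto intro!: mult mon cst polys_intros)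
  qed (auto intro: add polys_add)
  then show ?thesis ..
qed

text \<open>Needed to use the definition of \<open>V_mod\<close>, since a sum over an infinite index
  set is 0 by convention.\<close>

lemma finite_staircase: "finite (staircase n)"
proof -
  let ?F = "{f :: nat \<Rightarrow> nat. \<forall>i. (i \<in> {1..n} \<longrightarrow> f i \<in> {..n}) \<and> (i \<notin> {1..n} \<longrightarrow> f i = 0)}"
  have "Poly_Mapping.lookup m \<in> ?F" if m: "m \<in> staircase n" for m
  proof -
    have "Poly_Mapping.lookup m i \<le> n" if "i \<in> {1..n}" for i
      using m that by (intro le_trans[OF _ diff_le_self[of n i]]) (simp add: staircase_def)
    moreover have "Poly_Mapping.lookup m i = 0" if "i \<notin> {1..n}" for i
      using m that by (metis (mono_tags, lifting) in_keys_iff mem_Collect_eq staircase_def subsetD)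
    ultimately show ?thesis by simp
  qed
  then have "Poly_Mapping.lookup ` staircase n \<subseteq> ?F" by (rule image_subsetI)
  then have "finite (Poly_Mapping.lookup ` staircase n)"
    by (rule finite_subset) (intro finite_set_of_finite_funs finite_atLeastAtMost finite_atMost)
  then show ?thesis
    by (rule finite_imageD) (auto intro!: inj_onI poly_mapping_eqI)
qed

lemma V_mod_iff: "p \<in> V_mod n \<longleftrightarrow> Poly_Mapping.keys p \<subseteq> staircase n"
proof
  assume "p \<in> V_mod n"
  then obtain r where p: "p = (\<Sum>m\<in>staircase n. mon m * cst (r m))"
    unfolding V_mod_def by blast
  show "Poly_Mapping.keys p \<subseteq> staircase n"
    unfolding p mon_mult_cst by (rule keys_sum_subset) simp
next
  assume "Poly_Mapping.keys p \<subseteq> staircase n"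
  then have "p = (\<Sum>m\<in>staircase n. mon m * cst (Poly_Mapping.lookup p m))"
    unfolding mon_mult_cst
    by (intro trans[OF mpol_expand sum.mono_neutral_left] finite_staircase) (auto simp: in_keys_iff)
  then show "p \<in> V_mod n"
    unfolding V_mod_def by blast
qed

lemma V_mod_polys: "p \<in> V_mod n \<Longrightarrow> p \<in> polys n"
  by (auto simp: V_mod_iff polys_def staircase_def)

lemma V_mod_0: "0 \<in> V_mod n"
  by (simp add: V_mod_iff)

lemma V_mod_1: "1 \<in> V_mod n"
  by (simp add: V_mod_iff staircase_def)

lemma V_mod_add: "p \<in> V_mod n \<Longrightarrow> q \<in> V_mod n \<Longrightarrow> p + q \<in> V_mod n"
  by (simp add: V_mod_iff keys_add_subset)

lemma V_mod_uminus: "p \<in> V_mod n \<Longrightarrow> - p \<in> V_mod n"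
  by (simp add: V_mod_iff)

lemma V_mod_mult_cst: "p \<in> V_mod n \<Longrightarrow> p * cst r \<in> V_mod n"
  unfolding V_mod_iff using keys_mult_cst by blast

lemma V_mod_cst_mult: "p \<in> V_mod n \<Longrightarrow> cst r * p \<in> V_mod n"
  unfolding V_mod_iff using keys_cst_mult by blast

lemma V_mod_mon: "mon m \<in> V_mod n \<longleftrightarrow> m \<in> staircase n"
  by (simp add: V_mod_iff)

lemma End_V_memD:
  assumes "T \<in> carrier (End_V n)"
  shows "T \<in> extensional (V_mod n)" "p \<in> V_mod n \<Longrightarrow> T p \<in> V_mod n"
    and "p \<in> V_mod n \<Longrightarrow> q \<in> V_mod n \<Longrightarrow> T (p + q) = T p + T q"
    and "p \<in> V_mod n \<Longrightarrow> T (p * cst r) = T p * cst r"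
  using assms by (auto simp: End_V_def PiE_def)

lemma End_V_memI:
  assumes "T \<in> extensional (V_mod n)" "\<And>p. p \<in> V_mod n \<Longrightarrow> T p \<in> V_mod n"
    and "\<And>p q. p \<in> V_mod n \<Longrightarrow> q \<in> V_mod n \<Longrightarrow> T (p + q) = T p + T q"
    and "\<And>p r. p \<in> V_mod n \<Longrightarrow> T (p * cst r) = T p * cst r"
  shows "T \<in> carrier (End_V n)"
  using assms by (auto simp: End_V_def PiE_def)

lemma End_V_ops:
  "S \<oplus>\<^bsub>End_V n\<^esub> T = (\<lambda>p\<in>V_mod n. S p + T p)"
  "S \<otimes>\<^bsub>End_V n\<^esub> T = compose (V_mod n) S T"
  "\<one>\<^bsub>End_V n\<^esub> = (\<lambda>p\<in>V_mod n. p)" "\<zero>\<^bsub>End_V n\<^esub> = (\<lambda>p\<in>V_mod n. 0)"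
  by (simp_all add: End_V_def)

lemma End_V_closed:
  assumes "S \<in> carrier (End_V n)" "T \<in> carrier (End_V n)"
  shows "S \<oplus>\<^bsub>End_V n\<^esub> T \<in> carrier (End_V n)" "S \<otimes>\<^bsub>End_V n\<^esub> T \<in> carrier (End_V n)"
proof -
  note m = End_V_memD[OF assms(1)] End_V_memD[OF assms(2)]
  show "S \<oplus>\<^bsub>End_V n\<^esub> T \<in> carrier (End_V n)"
    unfolding End_V_ops by (rule End_V_memI) (simp_all add: m V_mod_add V_mod_mult_cst algebra_simps)
  show "S \<otimes>\<^bsub>End_V n\<^esub> T \<in> carrier (End_V n)"
    unfolding End_V_ops by (rule End_V_memI) (simp_all add: m V_mod_add V_mod_mult_cst compose_def)
qed

lemma End_V_const_closed: "\<one>\<^bsub>End_V n\<^esub> \<in> carrier (End_V n)" "\<zero>\<^bsub>End_V n\<^esub> \<in> carrier (End_V n)"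
  unfolding End_V_ops by (rule End_V_memI; simp add: V_mod_0 V_mod_add V_mod_mult_cst)+

lemma ring_End_V: "ring (End_V n :: ('a::ring_1 mpol \<Rightarrow> 'a mpol) ring)"
proof (rule ringI)
  let ?E = "End_V n :: ('a mpol \<Rightarrow> 'a mpol) ring"
  note ext = extensionalityI[where A = "V_mod n"]
  show "abelian_group ?E"
  proof (rule abelian_groupI)
    fix T assume T: "T \<in> carrier ?E"
    note m = End_V_memD[OF T]
    show "\<zero>\<^bsub>?E\<^esub> \<oplus>\<^bsub>?E\<^esub> T = T"
      unfolding End_V_ops by (rule ext) (simp_all add: m)
    have "(\<lambda>p\<in>V_mod n. - T p) \<in> carrier ?E"
      by (rule End_V_memI) (simp_all add: m V_mod_add V_mod_mult_cst V_mod_uminus)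
    moreover have "(\<lambda>p\<in>V_mod n. - T p) \<oplus>\<^bsub>?E\<^esub> T = \<zero>\<^bsub>?E\<^esub>"
      unfolding End_V_ops by (rule ext) simp_all
    ultimately show "\<exists>S\<in>carrier ?E. S \<oplus>\<^bsub>?E\<^esub> T = \<zero>\<^bsub>?E\<^esub>" by blast
  next
    fix S T assume "S \<in> carrier ?E" "T \<in> carrier ?E"
    show "S \<oplus>\<^bsub>?E\<^esub> T = T \<oplus>\<^bsub>?E\<^esub> S"
      unfolding End_V_ops by (rule ext) (simp_all add: add.commute)
  next
    fix S T U assume "S \<in> carrier ?E" "T \<in> carrier ?E" "U \<in> carrier ?E"
    show "S \<oplus>\<^bsub>?E\<^esub> T \<oplus>\<^bsub>?E\<^esub> U = S \<oplus>\<^bsub>?E\<^esub> (T \<oplus>\<^bsub>?E\<^esub> U)"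
      unfolding End_V_ops by (rule ext) (simp_all add: add.assoc)
  qed (rule End_V_closed End_V_const_closed; assumption?)+
  show "monoid ?E"
  proof (rule monoidI)
    fix S T U assume "S \<in> carrier ?E" "T \<in> carrier ?E" and U: "U \<in> carrier ?E"
    show "S \<otimes>\<^bsub>?E\<^esub> T \<otimes>\<^bsub>?E\<^esub> U = S \<otimes>\<^bsub>?E\<^esub> (T \<otimes>\<^bsub>?E\<^esub> U)"
      unfolding End_V_ops by (rule ext) (simp_all add: compose_def End_V_memD[OF U])
  next
    fix T assume T: "T \<in> carrier ?E"
    note m = End_V_memD[OF T]
    show "\<one>\<^bsub>?E\<^esub> \<otimes>\<^bsub>?E\<^esub> T = T" "T \<otimes>\<^bsub>?E\<^esub> \<one>\<^bsub>?E\<^esub> = T"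
      unfolding End_V_ops by (rule ext; simp add: m compose_def)+
  qed (rule End_V_closed End_V_const_closed; assumption?)+
  fix S T U assume "S \<in> carrier ?E" "T \<in> carrier ?E" and U: "U \<in> carrier ?E"
  note m = End_V_memD[OF \<open>S \<in> _\<close>] End_V_memD[OF \<open>T \<in> _\<close>] End_V_memD[OF U]
  show "(S \<oplus>\<^bsub>?E\<^esub> T) \<otimes>\<^bsub>?E\<^esub> U = S \<otimes>\<^bsub>?E\<^esub> U \<oplus>\<^bsub>?E\<^esub> T \<otimes>\<^bsub>?E\<^esub> U"
    "U \<otimes>\<^bsub>?E\<^esub> (S \<oplus>\<^bsub>?E\<^esub> T) = U \<otimes>\<^bsub>?E\<^esub> S \<oplus>\<^bsub>?E\<^esub> U \<otimes>\<^bsub>?E\<^esub> T"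
    unfolding End_V_ops by (rule ext; simp add: m compose_def)+
qed

section \<open>Words in the non-commuting variables and expansion in powers of one variable\<close>

lemma sum_list_ordered_word:
  assumes "Poly_Mapping.keys b \<subseteq> {1..<i}"
  shows "sum_list (map (\<lambda>j. Poly_Mapping.single j 1) (ordered_word i b)) = b"
proof -
  have rep: "sum_list (map (\<lambda>j. Poly_Mapping.single j (Suc 0)) (replicate k j)) = Poly_Mapping.single j k" for j k :: nat
    by (induction k) (simp_all flip: Poly_Mapping.single_add)
  have "sum_list (map (\<lambda>j. Poly_Mapping.single j 1)
      (concat (map (\<lambda>j. replicate (Poly_Mapping.lookup b j) j) js))) =
    sum_list (map (\<lambda>j. Poly_Mapping.single j (Poly_Mapping.lookup b j)) js)" for js
    by (induction js) (simp_all add: rep del: map_replicate)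
  then have "sum_list (map (\<lambda>j. Poly_Mapping.single j 1) (ordered_word i b)) =
      (\<Sum>j\<in>{1..<i}. Poly_Mapping.single j (Poly_Mapping.lookup b j))"
    unfolding ordered_word_def by (simp add: sum_list_distinct_conv_sum_set)
  also have "\<dots> = b"
    using assms by (intro poly_mapping_eqI) (auto simp: lookup_sum lookup_single when_def in_keys_iff)
  finally show ?thesis .
qed

lemma coeff_of_power_lin:
  "coeff_of_power i k = lin (\<lambda>m. if Poly_Mapping.lookup m i = k then mon (Poly_Mapping.update i 0 m) else 0)"
proof
  fix p :: "'a mpol"
  show "coeff_of_power i k p = lin (\<lambda>m. if Poly_Mapping.lookup m i = k then mon (Poly_Mapping.update i 0 m) else 0) p"
    unfolding coeff_of_power_def lin_def
    by (rule sum.mono_neutral_cong_left) (auto simp: mon_mult_cst)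
qed

lemma sum_coeff_of_power:
  assumes "Poly_Mapping.keys p \<subseteq> {m. Poly_Mapping.lookup m i \<le> K}"
  shows "(\<Sum>k=0..K. coeff_of_power i k p * polyX i ^ k) = p"
  using assms
proof (induction p rule: mpol_induct)
  case (single m r)
  let ?u = "mon (Poly_Mapping.update i 0 m) :: 'a mpol" and ?e = "Poly_Mapping.lookup m i"
  have "(\<Sum>k=0..K. coeff_of_power i k (Poly_Mapping.single m r) * polyX i ^ k) =
      (\<Sum>k=0..K. if ?e = k then ?u * cst r * polyX i ^ k else 0)"
    by (rule sum.cong) (auto simp: coeff_of_power_lin lin_single)
  also have "\<dots> = ?u * cst r * polyX i ^ ?e"
    using single by simp
  also have "\<dots> = ?u * polyX i ^ ?e * cst r"
    by (simp only: mult.assoc centralD[OF central_power[OF central_polyX]])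
  finally show ?case by (simp only: mon_split[symmetric] mon_mult_cst)
qed (simp_all add: coeff_of_power_lin lin_add distrib_right sum.distrib)

lemma coeff_of_power_polys:
  assumes "p \<in> polys (Suc j)" shows "coeff_of_power (Suc j) k p \<in> polys j"
proof -
  have "Poly_Mapping.keys (coeff_of_power (Suc j) k p) \<subseteq> {m. Poly_Mapping.keys m \<subseteq> {1..j}}"
    unfolding coeff_of_power_lin
  proof (rule keys_lin)
    fix m assume "m \<in> Poly_Mapping.keys p"
    then have "Poly_Mapping.keys m \<subseteq> {1..Suc j}" using assms by (auto simp: polys_def)
    then have "Poly_Mapping.keys (Poly_Mapping.update (Suc j) 0 m) \<subseteq> {1..j}"
      by (auto simp: keys_update le_Suc_eq)
    then show "Poly_Mapping.keys (if Poly_Mapping.lookup m (Suc j) = k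
        then mon (Poly_Mapping.update (Suc j) 0 m) else 0 :: 'a mpol) \<subseteq> {m. Poly_Mapping.keys m \<subseteq> {1..j}}"
      by simp
  qed
  then show ?thesis by (auto simp: polys_def)
qed

lemma polyX_mult_mon: "polyX i * mon m = mon (m + Poly_Mapping.single i 1)"
  by (simp add: polyX_def add.commute flip: mon_add)

lemma update_staircase:
  "m \<in> staircase n \<Longrightarrow> i \<in> {1..n} \<Longrightarrow> k \<le> n - i \<Longrightarrow> Poly_Mapping.update i k m \<in> staircase n"
  by (auto simp: staircase_def keys_update lookup_update)

lemma mon_update: "mon (Poly_Mapping.update i k m) = polyX i ^ k * mon (Poly_Mapping.update i 0 m)"
proof -
  have "Poly_Mapping.update i k m = Poly_Mapping.single i k + Poly_Mapping.update i 0 m"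
    by (rule poly_mapping_eqI) (auto simp: lookup_add lookup_single lookup_update when_def)
  then show ?thesis by (simp add: mon_add mon_single)
qed

subsection \<open>The action by normal forms\<close>

lemma mon_split_left:
  "mon m = polyX i ^ Poly_Mapping.lookup m i * mon (Poly_Mapping.update i 0 m)"
  using mon_split centralD[OF central_mon] by (rule trans)

context central_coeffs
begin

lemma nf_V_mod: "p \<in> polys n \<Longrightarrow> nf n p \<in> V_mod n"
  by (simp add: V_mod_iff keys_nf)

lemma nf_id: "p \<in> V_mod n \<Longrightarrow> nf n p = p"
  by (simp add: V_mod_iff nf_fixed)

text \<open>Multiplication in R_f, transported to V along the normal form.\<close>

definition act :: "'a mpol \<Rightarrow> 'a mpol \<Rightarrow> 'a mpol"
  where "act p = (\<lambda>v\<in>V_mod n. nf n (p * v))"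

lemma act_apply: "v \<in> V_mod n \<Longrightarrow> act p v = nf n (p * v)"
  by (simp add: act_def)

lemma act_closed: "p \<in> polys n \<Longrightarrow> act p \<in> carrier (End_V n)"
  unfolding act_def
  by (rule End_V_memI)
    (simp_all add: nf_V_mod polys_mult V_mod_polys V_mod_add V_mod_mult_cst distrib_left nf_add
      nf_mult_cst flip: mult.assoc)

lemma act_mult:
  assumes "p \<in> polys n" "q \<in> polys n"
  shows "act (p * q) = act p \<otimes>\<^bsub>End_V n\<^esub> act q"
proof (rule extensionalityI[where A = "V_mod n"])
  fix v :: "'a mpol" assume v: "v \<in> V_mod n"
  have qv: "q * v \<in> polys n" by (rule polys_mult[OF assms(2) V_mod_polys[OF v]])
  have "(act p \<otimes>\<^bsub>End_V n\<^esub> act q) v = act p (nf n (q * v))"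
    using v by (simp add: End_V_ops compose_def act_apply)
  also have "\<dots> = nf n (p * (q * v))"
    using qv assms(1) by (simp add: act_apply nf_V_mod nf_mult_nf)
  finally show "act (p * q) v = (act p \<otimes>\<^bsub>End_V n\<^esub> act q) v"
    using v by (simp add: act_apply mult.assoc)
qed (simp_all add: act_def End_V_ops)

lemma act_add: "act (p + q) = act p \<oplus>\<^bsub>End_V n\<^esub> act q"
  by (rule extensionalityI[where A = "V_mod n"])
    (simp_all add: act_def End_V_ops distrib_right nf_add)

lemma act_1: "act 1 = \<one>\<^bsub>End_V n\<^esub>"
  by (rule extensionalityI[where A = "V_mod n"]) (simp_all add: act_def End_V_ops nf_id)

lemma act_cst: "act (cst r) = left_mult n r"
  by (rule extensionalityI[where A = "V_mod n"])
    (simp_all add: act_def left_mult_def nf_id V_mod_cst_mult)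

lemma act_hom: "act \<in> ring_hom (poly_ring n) (End_V n)"
  by (rule ring_hom_memI) (simp_all add: poly_ring_def act_closed act_mult act_add act_1)

text \<open>Both maps are right linear, so each operator needs to be compared with
  \<open>act\<close> only on basis monomials.\<close>

lemma right_lin_ext_eq_act:
  assumes "\<And>m. m \<in> staircase n \<Longrightarrow> g m = nf n (p * mon m)"
  shows "right_lin_ext n g = act p"
proof (rule extensionalityI[where A = "V_mod n"])
  fix v :: "'a mpol" assume v: "v \<in> V_mod n"
  then have "right_lin_ext n g v =
      (\<Sum>m\<in>Poly_Mapping.keys v. nf n (p * mon m) * cst (Poly_Mapping.lookup v m))"
    unfolding right_lin_ext_def using assms by (auto simp: V_mod_iff intro!: sum.cong)
  also have "\<dots> = lin (\<lambda>m. nf n (p * mon m)) v"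
    by (simp add: lin_def)
  also have "\<dots> = nf n (p * v)"
  proof (rule lin_eqI[symmetric])
    fix m and r :: 'a
    show "nf n (p * Poly_Mapping.single m r) = nf n (p * mon m) * cst r"
      by (simp flip: mon_mult_cst nf_mult_cst mult.assoc)
  qed (simp add: distrib_left nf_add)
  finally show "right_lin_ext n g v = act p v"
    using v by (simp add: act_apply)
qed (simp_all add: act_def right_lin_ext_def)

lemma foldr_act:
  assumes "\<And>j. j \<in> set w \<Longrightarrow> j \<in> {1..n} \<and> L j = act (polyX j)" and v: "v \<in> V_mod n"
  shows "foldr L w v = nf n (mon (sum_list (map (\<lambda>j. Poly_Mapping.single j 1) w)) * v)"
  using assms(1)
proof (induction w)
  case Nil
  then show ?case using v by (simp add: nf_id)
next
  case (Cons j w)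
  let ?q = "mon (sum_list (map (\<lambda>j. Poly_Mapping.single j 1) w)) * v"
  have "Poly_Mapping.keys (sum_list (map (\<lambda>j. Poly_Mapping.single j (1::nat)) w)) \<subseteq> {1..n}"
    using Cons.prems by (induction w) (auto simp: keys_expo_add)
  then have q: "?q \<in> polys n"
    by (intro polys_mult polys_mon V_mod_polys v)
  have "foldr L (j # w) v = act (polyX j) (nf n ?q)"
    using Cons by simp
  also have "\<dots> = nf n (polyX j * ?q)"
    using Cons.prems[of j] q by (simp add: act_apply nf_V_mod nf_mult_nf polys_polyX)
  finally show ?case by (simp add: mon_add polyX_def mult.assoc)
qed

lemma nc_act_to_nc:
  assumes L: "\<And>j. j \<in> {1..<i} \<Longrightarrow> L j = act (polyX j)"
    and i: "i \<le> Suc n" and q: "q \<in> polys (i - 1)" and v: "v \<in> V_mod n"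
  shows "nc_act n L (to_nc i q) v = nf n (q * v)"
proof -
  \<comment> \<open>Additivity of \<open>G\<close> lets it be applied term by term to
    \<open>to_nc\<close>, without checking that distinct exponents give distinct words.\<close>
  define G where "G p = (\<Sum>w\<in>Poly_Mapping.keys p. cst (Poly_Mapping.lookup p w) * foldr L w v)"
    for p :: "'a ncpol"
  have G_add: "G (p + p') = G p + G p'" for p p'
    unfolding G_def by (rule setsum_keys_plus_distrib) (simp_all add: cst_add distrib_right)
  have G_sum: "G (\<Sum>x\<in>A. f x) = (\<Sum>x\<in>A. G (f x))" for A :: "expo set" and f
    by (induction A rule: infinite_finite_induct) (simp_all add: G_add, simp_all add: G_def)
  have G_single: "G (Poly_Mapping.single w r) = cst r * foldr L w v" for w r
    by (simp add: G_def)
  have word: "foldr L (ordered_word i b) v = nf n (mon b * v)" if "b \<in> Poly_Mapping.keys q" for b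
  proof -
    have b: "Poly_Mapping.keys b \<subseteq> {1..<i}"
      using q that by (fastforce simp: polys_def)
    have "j \<in> {1..n} \<and> L j = act (polyX j)" if "j \<in> set (ordered_word i b)" for j
    proof -
      have "j \<in> {1..<i}" using that by (auto simp: ordered_word_def split: if_splits)
      then show ?thesis using L i by auto
    qed
    from foldr_act[OF this v] show ?thesis
      by (simp only: sum_list_ordered_word[OF b])
  qed
  have "nc_act n L (to_nc i q) v = G (to_nc i q)"
    using v by (simp add: nc_act_def G_def)
  also have "\<dots> = (\<Sum>b\<in>Poly_Mapping.keys q. cst (Poly_Mapping.lookup q b) * nf n (mon b * v))"
    unfolding to_nc_def G_sum G_single by (rule sum.cong) (simp_all add: word)
  also have "\<dots> = nf n ((\<Sum>b\<in>Poly_Mapping.keys q. Poly_Mapping.single b (Poly_Mapping.lookup q b)) * v)"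
    by (simp add: sum_distrib_right nf_sum mult.assoc flip: nf_cst_mult cst_mult_mon)
  finally show ?thesis by (simp only: mpol_expand[symmetric])
qed

section \<open>Identification of the operators on basis monomials\<close>

lemma L_first_eq:
  assumes m: "m \<in> staircase n" and n: "n \<ge> 1"
  shows "L_first n a m = nf n (polyX 1 * mon m)"
proof (cases "Poly_Mapping.lookup m 1 < n - 1")
  case True
  then have "m + Poly_Mapping.single 1 1 \<in> staircase n"
    using m n by (auto simp: staircase_def keys_expo_add lookup_add lookup_single when_def)
  then show ?thesis
    using True by (simp add: L_first_def polyX_mult_mon nf_id V_mod_mon)
next
  case False
  let ?u = "mon (Poly_Mapping.update 1 0 m) :: 'a mpol"
  let ?t = "\<Sum>k=1..n. (- 1) ^ (k - 1) * cst (a k) * mon (Poly_Mapping.update 1 (n - k) m)"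
  \<comment> \<open>The staircase bound forces the extremal exponent, so multiplying by X_1 produces
    X_1^n, which f_1 rewrites as \<open>?t\<close>.\<close>
  have "Poly_Mapping.lookup m 1 = n - 1"
    using False m n by (auto simp: staircase_def intro: antisym)
  then have "mon m = polyX 1 ^ (n - 1) * ?u"
    by (simp only: mon_split_left[of m 1])
  moreover have "polyX 1 ^ n = polyX 1 * (polyX 1 ^ (n - 1) :: 'a mpol)"
    using n by (cases n) simp_all
  ultimately have X: "polyX 1 * mon m = polyX 1 ^ n * ?u"
    by (simp only: mult.assoc)
  have "f_at n a (polyX 1) * ?u = polyX 1 ^ n * ?u - ?t"
  proof -
    have "(- 1) ^ k * cst (a k) * polyX 1 ^ (n - k) * ?u =
        - ((- 1) ^ (k - 1) * cst (a k) * mon (Poly_Mapping.update 1 (n - k) m))" if "k \<in> {1..n}" for k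
      using that unfolding mon_update[of 1 "n - k" m] by (cases k) (simp_all add: mult.assoc)
    then show ?thesis
      by (simp add: f_at_def distrib_right sum_distrib_right sum_negf)
  qed
  moreover have "nf n (f_at n a (polyX 1) * ?u) = 0"
    using nf_F_mult[of 0 n ?u] div_diff_f_coeff_1[of n a] n by simp
  ultimately have "nf n (polyX 1 * mon m) = nf n ?t"
    unfolding X by (simp add: nf_diff)
  also have "\<dots> = ?t"
  proof (intro nf_id)
    have "(- 1) ^ (k - 1) * cst (a k) * mon (Poly_Mapping.update 1 (n - k) m) \<in> V_mod n" if "k \<in> {1..n}" for k
    proof -
      have "mon (Poly_Mapping.update 1 (n - k) m) \<in> V_mod n"
        unfolding V_mod_mon using m that by (intro update_staircase) auto
      then have "cst (a k) * mon (Poly_Mapping.update 1 (n - k) m) \<in> V_mod n"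
        by (rule V_mod_cst_mult)
      then show ?thesis
        using V_mod_uminus by (cases "even (k - 1)") (simp_all add: mult.assoc)
    qed
    then show "?t \<in> V_mod n"
      unfolding V_mod_iff by (rule keys_sum_subset)
  qed
  finally show ?thesis using False by (simp add: L_first_def)
qed

text \<open>Once the earlier operators are known to act by multiplication, the order of letters in
  \<open>to_nc\<close> is immaterial and L^{i-1} of h_k is multiplication by h_k. The defining sum
  then becomes the normal form of (X_i^d - f_i) times the remaining monomial.\<close>

lemma L_later_eq:
  assumes m: "m \<in> staircase n" and j: "Suc j \<le> n"
    and L: "\<And>l. l \<in> {1..j} \<Longrightarrow> L l = act (polyX l)"
  shows "L_later n a L (Suc j) m = nf n (polyX (Suc j) * mon m)"
proof (cases "Poly_Mapping.lookup m (Suc j) < n - Suc j")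
  case True
  then have "m + Poly_Mapping.single (Suc j) 1 \<in> staircase n"
    using m j by (auto simp: staircase_def keys_expo_add lookup_add lookup_single when_def)
  then show ?thesis
    using True by (simp add: L_later_def polyX_mult_mon nf_id V_mod_mon)
next
  case False
  let ?i = "Suc j"
  let ?X = "polyX ?i :: 'a mpol"
  let ?u = "mon (Poly_Mapping.update ?i 0 m) :: 'a mpol"
  let ?d = "n - j"
  define h where "h = ?X ^ ?d - F ?i ?d"
  have h_coeff: "h_coeff n a ?i k = coeff_of_power ?i k h" for k
    using f_seq_eq_div_diff[of ?i n a] j by (simp add: h_coeff_def h_def)
  have "h \<in> polys ?i"
    unfolding h_def by (intro polys_diff polys_power polys_polyX F_polys) simp
  have h_eq: "h = (\<Sum>k<?d. red_coeff j k * ?X ^ k)"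
    by (simp add: h_def F_monic)
  have "Poly_Mapping.keys (red_coeff j k * ?X ^ k) \<subseteq> {m. Poly_Mapping.lookup m ?i \<le> n - ?i}"
    if "k < ?d" for k
  proof
    fix x assume "x \<in> Poly_Mapping.keys (red_coeff j k * ?X ^ k)"
    then obtain y where "x = y + Poly_Mapping.single ?i k" "y \<in> Poly_Mapping.keys (red_coeff j k)"
      using keys_mult[of "red_coeff j k" "?X ^ k"] by (auto simp flip: mon_single)
    then show "x \<in> {m. Poly_Mapping.lookup m ?i \<le> n - ?i}"
      using red_coeff_free[of j k] that by (auto simp: lookup_add)
  qed
  \<comment> \<open>Since f_i is monic, h has degree below n - j in X_i; hence the sum up to n - i
    recovers all of h.\<close>
  then have "Poly_Mapping.keys h \<subseteq> {m. Poly_Mapping.lookup m ?i \<le> n - ?i}"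
    unfolding h_eq by (intro keys_sum_subset) simp
  note h_sum = sum_coeff_of_power[OF this]
  have "L_later n a L ?i m =
      (\<Sum>k=0..n - ?i. nf n (coeff_of_power ?i k h * mon (Poly_Mapping.update ?i k m)))"
    unfolding L_later_def using False
  proof (simp only: if_False h_coeff, intro sum.cong refl nc_act_to_nc)
    fix k assume "k \<in> {0..n - ?i}"
    then show "mon (Poly_Mapping.update ?i k m) \<in> V_mod n"
      unfolding V_mod_mon using m j by (intro update_staircase) auto
  qed (use L j coeff_of_power_polys[OF \<open>h \<in> polys ?i\<close>] in auto)
  also have "\<dots> = nf n ((\<Sum>k=0..n - ?i. coeff_of_power ?i k h * ?X ^ k) * ?u)"
    unfolding sum_distrib_right nf_sum mult.assoc mon_update[of ?i, symmetric] ..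
  also have "\<dots> = nf n (h * ?u)"
    by (simp only: h_sum)
  also have "\<dots> = nf n (?X ^ ?d * ?u)"
    using nf_F_mult[of j n ?u] j by (simp add: h_def left_diff_distrib nf_diff)
  also have "?X ^ ?d * ?u = ?X * mon m"
  proof -
    have "Poly_Mapping.lookup m ?i = n - ?i"
      using False m j by (auto simp: staircase_def intro: antisym)
    then have "mon m = ?X ^ (n - ?i) * ?u"
      by (simp only: mon_split_left[of m ?i])
    moreover have "?d = Suc (n - ?i)" using j by simp
    ultimately show ?thesis by (simp add: mult.assoc)
  qed
  finally show ?thesis .
qed

lemma L_upto_eq_act: "i \<le> n \<Longrightarrow> j \<in> {1..i} \<Longrightarrow> L_upto n a i j = act (polyX j)"
proof (induction i arbitrary: j)
  case (Suc i)
  show ?case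
  proof (cases "j = Suc i")
    case True
    have "(if i = 0 then L_first n a else L_later n a (L_upto n a i) (Suc i)) m = nf n (polyX (Suc i) * mon m)"
      if "m \<in> staircase n" for m
      using L_first_eq[OF that] L_later_eq[OF that] Suc by auto
    from right_lin_ext_eq_act[OF this] show ?thesis by (simp add: True)
  qed (use Suc in auto)
qed simp

lemma LY_eq_act: "i \<in> {1..n} \<Longrightarrow> LY n a i = act (polyX i)"
  unfolding LY_def by (rule L_upto_eq_act) auto

section \<open>Commutation, uniqueness of the homomorphism, kernel and image\<close>

lemma act_commute:
  assumes "p \<in> polys n" "q \<in> polys n" "central p"
  shows "act p \<otimes>\<^bsub>End_V n\<^esub> act q = act q \<otimes>\<^bsub>End_V n\<^esub> act p"
  using assms act_mult centralD by metis

lemma extending_homs_unique: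
  assumes "\<Phi> \<in> extending_homs n a" "p \<in> polys n"
  shows "\<Phi> p = act p"
proof -
  have hom: "\<Phi> \<in> ring_hom (poly_ring n) (End_V n)"
    and vals: "\<And>r. \<Phi> (cst r) = left_mult n r" "\<And>i. i \<in> {1..n} \<Longrightarrow> \<Phi> (polyX i) = LY n a i"
    using assms(1) by (auto simp: extending_homs_def)
  from assms(2) show ?thesis
  proof (induction p rule: polys_induct)
    case (add p q)
    then show ?case using ring_hom_add[OF hom, of p q] by (simp add: poly_ring_def act_add)
  next
    case (mult p q)
    then show ?case using ring_hom_mult[OF hom, of p q] by (simp add: poly_ring_def act_mult)
  qed (simp_all add: vals act_cst LY_eq_act)
qed

text \<open>Homomorphisms are determined only on the carrier; the restriction fixes the values
  elsewhere, as unique existence demands.\<close>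

lemma restrict_act_extending: "restrict act (polys n) \<in> extending_homs n a"
proof -
  have "restrict act (polys n) \<in> ring_hom (poly_ring n) (End_V n)"
    using act_hom by (auto simp: ring_hom_def poly_ring_def polys_intros)
  then show ?thesis
    by (simp add: extending_homs_def polys_basic polys_polyX act_cst LY_eq_act)
qed

lemma act_eq_zero_iff:
  assumes "p \<in> polys n" shows "act p = \<zero>\<^bsub>End_V n\<^esub> \<longleftrightarrow> p \<in> ideal_f n a"
proof
  assume "act p = \<zero>\<^bsub>End_V n\<^esub>"
  \<comment> \<open>Evaluation at 1 recovers the normal form of p itself.\<close>
  then have "act p 1 = 0" by (simp add: End_V_ops V_mod_1)
  then show "p \<in> ideal_f n a"
    using assms by (simp add: act_apply V_mod_1 nf_eq_0_iff)
next
  assume p: "p \<in> ideal_f n a"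
  show "act p = \<zero>\<^bsub>End_V n\<^esub>"
    unfolding act_def End_V_ops
    using nf_ideal_f[OF ideal_f_mult_right[OF p V_mod_polys]] by (intro restrict_ext) simp
qed

lemma act_kernel: "a_kernel (poly_ring n) (End_V n) act = ideal_f n a"
  using act_eq_zero_iff ideal_f_polys by (auto simp: a_kernel_def' poly_ring_def)

lemma act_image: "act ` polys n = generate_ring (End_V n) (LY n a ` {1..n} \<union> range (left_mult n))"
proof -
  interpret E: ring "End_V n :: ('a mpol \<Rightarrow> 'a mpol) ring" by (rule ring_End_V)
  interpret h: ring_hom_ring "poly_ring n" "End_V n" act
    by (rule ring_hom_ringI2[OF ring_poly_ring ring_End_V act_hom])
  let ?H = "LY n a ` {1..n} \<union> range (left_mult n)"
  have gens: "?H \<subseteq> act ` polys n"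
    by (auto simp: LY_eq_act simp flip: act_cst intro!: imageI polys_polyX polys_basic)
  have "act p \<in> generate_ring (End_V n) ?H" if "p \<in> polys n" for p
    using that
  proof (induction p rule: polys_induct)
    case (add p q)
    then show ?case unfolding act_add by (intro generate_ring.eng_add)
  next
    case (mult p q)
    then show ?case by (simp only: act_mult) (intro generate_ring.eng_mult)
  next
    case (cst r)
    show ?case unfolding act_cst by (rule generate_ring.incl) simp
  next
    case (polyX i)
    then show ?case unfolding LY_eq_act[OF polyX, symmetric] by (intro generate_ring.incl) simp
  qed
  moreover have "generate_ring (End_V n) ?H \<subseteq> act ` polys n"
  proof (rule E.generate_ring_min_subring1[OF _ _ gens])
    have "act ` polys n \<subseteq> carrier (End_V n)" by (rule image_subsetI) (rule act_closed)
    with gens show "?H \<subseteq> carrier (End_V n)" by (rule subset_trans)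
    show "subring (act ` polys n) (End_V n)"
      using h.img_is_subring[OF h.R.carrier_is_subring] by (simp add: poly_ring_def)
  qed
  ultimately show ?thesis by blast
qed

text \<open>First isomorphism theorem, with the codomain cut down to the image; the zero is
  unchanged, hence so is the kernel.\<close>

lemma quotient_iso: "poly_ring n Quot ideal_f n a \<simeq> R_LY n a"
proof -
  interpret E: ring "End_V n :: ('a mpol \<Rightarrow> 'a mpol) ring" by (rule ring_End_V)
  let ?G = "LY n a ` {1..n} \<union> range (left_mult n)"
  have "?G \<subseteq> carrier (End_V n)"
    by (auto simp: LY_eq_act polys_polyX polys_basic simp flip: act_cst intro!: act_closed)
  then have ring: "ring (R_LY n a)"
    unfolding R_LY_def by (rule E.generate_ring_is_ring)
  have carrier: "carrier (R_LY n a) = act ` carrier (poly_ring n)"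
    by (simp add: R_LY_def act_image poly_ring_def)
  have ops: "mult (R_LY n a) = mult (End_V n)" "add (R_LY n a) = add (End_V n)"
      "one (R_LY n a) = one (End_V n)" "zero (R_LY n a) = zero (End_V n)"
    by (simp_all add: R_LY_def)
  have "act \<in> ring_hom (poly_ring n) (R_LY n a)"
  proof (rule ring_hom_memI)
    show "act p \<in> carrier (R_LY n a)" if "p \<in> carrier (poly_ring n)" for p
      unfolding carrier using that by (rule imageI)
  qed (simp_all add: ops ring_hom_mult[OF act_hom] ring_hom_add[OF act_hom] ring_hom_one[OF act_hom])
  then interpret h: ring_hom_ring "poly_ring n" "R_LY n a" act
    by (rule ring_hom_ringI2[OF ring_poly_ring ring])
  have "a_kernel (poly_ring n) (R_LY n a) act = a_kernel (poly_ring n) (End_V n) act"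
    by (simp only: a_kernel_def' ops)
  then have "a_kernel (poly_ring n) (R_LY n a) act = ideal_f n a"
    by (simp only: act_kernel)
  with h.FactRing_iso[OF carrier[symmetric]] show ?thesis by (simp only:)
qed

end

theorem theorem4p1:
  fixes n :: nat and a :: "nat \<Rightarrow> 'a::ring_1"
  assumes "n \<ge> 1"
    and "\<And>k r. k \<in> {1..n} \<Longrightarrow> a k * r = r * a k"
  shows "(\<forall>i\<in>{1..n}. LY n a i \<in> carrier (End_V n)) \<and>
    (\<forall>i\<in>{1..n}. \<forall>j\<in>{1..n}.
       LY n a i \<otimes>\<^bsub>End_V n\<^esub> LY n a j = LY n a j \<otimes>\<^bsub>End_V n\<^esub> LY n a i) \<and>
    (\<forall>i\<in>{1..n}. \<forall>r.
       LY n a i \<otimes>\<^bsub>End_V n\<^esub> left_mult n r = left_mult n r \<otimes>\<^bsub>End_V n\<^esub> LY n a i) \<and>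
    (\<exists>!\<Phi>. \<Phi> \<in> extending_homs n a \<and> \<Phi> \<in> extensional (carrier (poly_ring n))) \<and>
    (\<forall>\<Phi>\<in>extending_homs n a. a_kernel (poly_ring n) (End_V n) \<Phi> = ideal_f n a) \<and>
    poly_ring n Quot ideal_f n a \<simeq> R_LY n a"
proof -
  interpret central_coeffs n a
    by unfold_locales (simp add: central_def assms(2))
  have carrier: "carrier (poly_ring n :: 'a mpol ring) = polys n"
    by (simp add: poly_ring_def)
  show ?thesis
  proof (intro conjI ballI allI)
    fix i assume i: "i \<in> {1..n}"
    show "LY n a i \<in> carrier (End_V n)"
      using i by (simp only: LY_eq_act) (intro act_closed polys_polyX)
    show "LY n a i \<otimes>\<^bsub>End_V n\<^esub> LY n a j = LY n a j \<otimes>\<^bsub>End_V n\<^esub> LY n a i" if "j \<in> {1..n}" for j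
      using i that by (simp only: LY_eq_act) (intro act_commute polys_polyX central_polyX)
    show "LY n a i \<otimes>\<^bsub>End_V n\<^esub> left_mult n r = left_mult n r \<otimes>\<^bsub>End_V n\<^esub> LY n a i" for r
      using i by (simp only: LY_eq_act act_cst[symmetric])
        (intro act_commute polys_polyX central_polyX polys_basic)
  next
    show "\<exists>!\<Phi>. \<Phi> \<in> extending_homs n a \<and> \<Phi> \<in> extensional (carrier (poly_ring n))"
    proof (rule ex1I)
      show "restrict act (polys n) \<in> extending_homs n a \<and>
          restrict act (polys n) \<in> extensional (carrier (poly_ring n))"
        using restrict_act_extending by (simp add: carrier)
    next
      fix \<Phi> assume \<Phi>: "\<Phi> \<in> extending_homs n a \<and> \<Phi> \<in> extensional (carrier (poly_ring n))"
      show "\<Phi> = restrict act (polys n)"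
        by (rule extensionalityI[where A = "polys n"])
          (use \<Phi> in \<open>simp_all add: carrier extending_homs_unique\<close>)
    qed
  next
    fix \<Phi> assume \<Phi>: "\<Phi> \<in> extending_homs n a"
    have "a_kernel (poly_ring n) (End_V n) \<Phi> = a_kernel (poly_ring n) (End_V n) act"
      unfolding a_kernel_def' carrier
      by (rule Collect_cong) (use extending_homs_unique[OF \<Phi>] in auto)
    then show "a_kernel (poly_ring n) (End_V n) \<Phi> = ideal_f n a"
      by (simp only: act_kernel)
  qed (rule quotient_iso)
qed

end
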